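(* The class of $BFU$-spaces includes: 1. separable Banach spaces; 2. reflexive Banach spaces; 3. products $X\times Y$ of a separable Banach space $X$ and a $BFU$-space $Y$; 4. products of any finite number of reflexive and separable Banach spaces; 5. quotient spaces of $BFU$-spaces (by closed subspaces); 6. (closed) complemented subspaces of $BFU$-spaces.
   Context: A Hausdorff topological space $(T,\tau)$ is Fréchet–Urysohn if for every set $G\subset T$ and every $t\in\overline G$ there is a sequence in $G$ converging to $t$. A Banach space $X$ is a $BFU$-space if every norm bounded set of functionals in $X^*$ is a Fréchet–Urysohn space in the topology induced by the weak$^*$ topology $\sigma(X^*,X)$. A finite product of Banach spaces carries the max norm. *)

theory Defs
  imports "HOL-Analysis.Analysis" "HOL-Algebra.Module" "HOL-Algebra.AbelCoset"
begin

text \<open>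
  Quotients by arbitrary closed subspaces and products of arbitrary finite families do not exist
  as types of class \<open>banach\<close>. Normed spaces are therefore carrier-based: modules in the sense of
  \<open>HOL-Algebra\<close> over the field of scalars, extended by a norm. The ring fields
  \<open>monoid.mult\<close> and \<open>monoid.one\<close>, which every module record contains, play no role.

  The scalar field is a type variable of sort \<open>{real_normed_field, euclidean_space}\<close>. The types
  \<open>real\<close> and \<open>complex\<close> are instances. They are the only ones up to isometric isomorphism, because
  a commutative real division algebra of finite dimension is real or complex, and it carries only
  one multiplicative norm.
\<close>

record ('k, 'a) normed_module = "('k, 'a) module" +
  nrm :: "'a \<Rightarrow> real"

definition scalar_ring :: "'k::{real_normed_field, euclidean_space} ring" where
  "scalar_ring = \<lparr>carrier = UNIV, monoid.mult = (*), one = 1, zero = 0, add = (+)\<rparr>"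

locale normed_space =
  Module.module "scalar_ring :: 'k::{real_normed_field, euclidean_space} ring" X
  for X :: "('k::{real_normed_field, euclidean_space}, 'a) normed_module" (structure) +
  assumes nrm_eq_0: "x \<in> carrier X \<Longrightarrow> nrm X x = 0 \<longleftrightarrow> x = \<zero>"
    and nrm_smult: "x \<in> carrier X \<Longrightarrow> nrm X (c \<odot> x) = norm c * nrm X x"
    and nrm_triangle: "x \<in> carrier X \<Longrightarrow> y \<in> carrier X \<Longrightarrow> nrm X (x \<oplus> y) \<le> nrm X x + nrm X y"

text \<open>The locale \<open>Metric_space\<close> wants symmetry and nonnegativity off the carrier too.\<close>

definition nrm_dist :: "('k, 'a) normed_module \<Rightarrow> 'a \<Rightarrow> 'a \<Rightarrow> real" where
  "nrm_dist X x y =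
     (if x \<in> carrier X \<and> y \<in> carrier X then nrm X (x \<ominus>\<^bsub>X\<^esub> y) else 0)"

definition nrm_topology :: "('k, 'a) normed_module \<Rightarrow> 'a topology" where
  "nrm_topology X = Metric_space.mtopology (carrier X) (nrm_dist X)"

definition banach_space ::
    "('k::{real_normed_field, euclidean_space}, 'a) normed_module \<Rightarrow> bool" where
  "banach_space X \<longleftrightarrow> normed_space X \<and> Metric_space.mcomplete (carrier X) (nrm_dist X)"

definition scalar_space :: "('k::{real_normed_field, euclidean_space}, 'k) normed_module" where
  "scalar_space = \<lparr>carrier = UNIV, monoid.mult = (*), one = 1, zero = 0, add = (+),
     smult = (*), nrm = norm\<rparr>"

text \<open>Maps are extensional, so that equality of maps is equality on the carrier.\<close>

definition bounded_linear_maps ::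
    "('k::{real_normed_field, euclidean_space}, 'a) normed_module \<Rightarrow> ('k, 'b) normed_module
      \<Rightarrow> ('a \<Rightarrow> 'b) set" where
  "bounded_linear_maps X Y =
     {T \<in> carrier X \<rightarrow>\<^sub>E carrier Y.
        (\<forall>x\<in>carrier X. \<forall>y\<in>carrier X. T (x \<oplus>\<^bsub>X\<^esub> y) = T x \<oplus>\<^bsub>Y\<^esub> T y) \<and>
        (\<forall>c. \<forall>x\<in>carrier X. T (c \<odot>\<^bsub>X\<^esub> x) = c \<odot>\<^bsub>Y\<^esub> T x) \<and>
        (\<exists>C. \<forall>x\<in>carrier X. nrm Y (T x) \<le> C * nrm X x)}"

definition dual_space ::
    "('k::{real_normed_field, euclidean_space}, 'a) normed_module
      \<Rightarrow> ('k, 'a \<Rightarrow> 'k) normed_module" where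
  "dual_space X = \<lparr>carrier = bounded_linear_maps X scalar_space,
     monoid.mult = undefined, one = undefined,
     zero = (\<lambda>x\<in>carrier X. 0),
     add = (\<lambda>f g. \<lambda>x\<in>carrier X. f x + g x),
     smult = (\<lambda>c f. \<lambda>x\<in>carrier X. c * f x),
     nrm = (\<lambda>f. SUP x\<in>{x \<in> carrier X. nrm X x \<le> 1}. norm (f x))\<rparr>"

text \<open>The weak* topology is the topology of pointwise convergence on the carrier of \<open>X\<close>.\<close>

definition weak_star_topology ::
    "('k::{real_normed_field, euclidean_space}, 'a) normed_module \<Rightarrow> ('a \<Rightarrow> 'k) topology" where
  "weak_star_topology X =
     subtopology (product_topology (\<lambda>_. euclidean) (carrier X)) (carrier (dual_space X))"

definition frechet_urysohn_space :: "'a topology \<Rightarrow> bool" where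
  "frechet_urysohn_space T \<longleftrightarrow> Hausdorff_space T \<and>
     (\<forall>G t. G \<subseteq> topspace T \<longrightarrow> t \<in> T closure_of G \<longrightarrow>
        (\<exists>s :: nat \<Rightarrow> 'a. range s \<subseteq> G \<and> limitin T s t sequentially))"

definition nrm_bounded :: "('k, 'a) normed_module \<Rightarrow> 'a set \<Rightarrow> bool" where
  "nrm_bounded X B \<longleftrightarrow> B \<subseteq> carrier X \<and> (\<exists>C. \<forall>x\<in>B. nrm X x \<le> C)"

definition BFU_space ::
    "('k::{real_normed_field, euclidean_space}, 'a) normed_module \<Rightarrow> bool" where
  "BFU_space X \<longleftrightarrow> banach_space X \<and>
     (\<forall>B. nrm_bounded (dual_space X) B \<longrightarrow>
        frechet_urysohn_space (subtopology (weak_star_topology X) B))"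

definition separable_banach_space ::
    "('k::{real_normed_field, euclidean_space}, 'a) normed_module \<Rightarrow> bool" where
  "separable_banach_space X \<longleftrightarrow> banach_space X \<and> separable_space (nrm_topology X)"

definition canonical_embedding ::
    "('k::{real_normed_field, euclidean_space}, 'a) normed_module \<Rightarrow> 'a \<Rightarrow> ('a \<Rightarrow> 'k) \<Rightarrow> 'k" where
  "canonical_embedding X x = (\<lambda>f\<in>carrier (dual_space X). f x)"

definition reflexive_banach_space ::
    "('k::{real_normed_field, euclidean_space}, 'a) normed_module \<Rightarrow> bool" where
  "reflexive_banach_space X \<longleftrightarrow> banach_space X \<and>
     canonical_embedding X ` carrier X = carrier (dual_space (dual_space X))"

definition prod_space ::
    "('k, 'a) normed_module \<Rightarrow> ('k, 'b) normed_module \<Rightarrow> ('k, 'a \<times> 'b) normed_module" where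
  "prod_space X Y = \<lparr>carrier = carrier X \<times> carrier Y,
     monoid.mult = undefined, one = undefined,
     zero = (\<zero>\<^bsub>X\<^esub>, \<zero>\<^bsub>Y\<^esub>),
     add = (\<lambda>(x, y) (x', y'). (x \<oplus>\<^bsub>X\<^esub> x', y \<oplus>\<^bsub>Y\<^esub> y')),
     smult = (\<lambda>c (x, y). (c \<odot>\<^bsub>X\<^esub> x, c \<odot>\<^bsub>Y\<^esub> y)),
     nrm = (\<lambda>(x, y). max (nrm X x) (nrm Y y))\<rparr>"

text \<open>
  The element \<open>0\<close> inserted below matters only for the empty product, the zero space. That all
  factors have carriers in one type is no restriction: finitely many spaces over different types
  can be transported to the sum of these types.
\<close>

definition finite_prod_space ::
    "'i set \<Rightarrow> ('i \<Rightarrow> ('k, 'a) normed_module) \<Rightarrow> ('k, 'i \<Rightarrow> 'a) normed_module" where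
  "finite_prod_space I X = \<lparr>carrier = (\<Pi>\<^sub>E i\<in>I. carrier (X i)),
     monoid.mult = undefined, one = undefined,
     zero = (\<lambda>i\<in>I. \<zero>\<^bsub>X i\<^esub>),
     add = (\<lambda>x y. \<lambda>i\<in>I. x i \<oplus>\<^bsub>X i\<^esub> y i),
     smult = (\<lambda>c x. \<lambda>i\<in>I. c \<odot>\<^bsub>X i\<^esub> x i),
     nrm = (\<lambda>x. Max (insert 0 ((\<lambda>i. nrm (X i) (x i)) ` I)))\<rparr>"

definition closed_subspace ::
    "'a set \<Rightarrow> ('k::{real_normed_field, euclidean_space}, 'a) normed_module \<Rightarrow> bool" where
  "closed_subspace M X \<longleftrightarrow> submodule M scalar_ring X \<and> closedin (nrm_topology X) M"

text \<open>
  Scalar multiplication of cosets is \<open>c (M + x) = M + c x\<close>. The union, rather than the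
  elementwise image, makes this correct for \<open>c = 0\<close>.
\<close>

definition quotient_space ::
    "('k, 'a) normed_module \<Rightarrow> 'a set \<Rightarrow> ('k, 'a set) normed_module" where
  "quotient_space X M = \<lparr>carrier = a_rcosets\<^bsub>X\<^esub> M,
     monoid.mult = undefined, one = undefined,
     zero = M,
     add = (\<lambda>S S'. S <+>\<^bsub>X\<^esub> S'),
     smult = (\<lambda>c S. \<Union>x\<in>S. M +>\<^bsub>X\<^esub> (c \<odot>\<^bsub>X\<^esub> x)),
     nrm = (\<lambda>S. INF x\<in>S. nrm X x)\<rparr>"

definition subspace_space :: "('k, 'a) normed_module \<Rightarrow> 'a set \<Rightarrow> ('k, 'a) normed_module" where
  "subspace_space X M = X\<lparr>carrier := M\<rparr>"

definition complemented_subspace ::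
    "'a set \<Rightarrow> ('k::{real_normed_field, euclidean_space}, 'a) normed_module \<Rightarrow> bool" where
  "complemented_subspace M X \<longleftrightarrow> closed_subspace M X \<and>
     (\<exists>P \<in> bounded_linear_maps X X. P ` carrier X = M \<and> (\<forall>x\<in>M. P x = x))"

lemma (in normed_space) nrm_nonneg:
  assumes x: "x \<in> carrier X" shows "0 \<le> nrm X x"
proof -
  have 1: "(1::'k) \<in> carrier scalar_ring" "(-1::'k) \<in> carrier scalar_ring"
    by (auto simp: scalar_ring_def)
  have "(0::'k) \<odot> x = \<zero>"
    using smult_l_null[OF x] by (simp add: scalar_ring_def)
  moreover have "(1 + (-1) :: 'k) \<odot> x = (1::'k) \<odot> x \<oplus> (-1::'k) \<odot> x"
    using smult_l_distr[OF 1 x] by (simp add: scalar_ring_def)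
  moreover have "\<zero> \<in> carrier X" by simp
  moreover have "(1::'k) \<odot> x \<in> carrier X" "(-1::'k) \<odot> x \<in> carrier X"
    using smult_closed 1 x by auto
  ultimately have "nrm X \<zero> \<le> nrm X ((1::'k) \<odot> x) + nrm X ((-1::'k) \<odot> x)"
    using nrm_triangle by (metis add.right_inverse)
  thus ?thesis using nrm_smult[OF x] nrm_eq_0[of \<zero>] by simp
qed

lemma (in normed_space) nrm_minus:
  assumes x: "x \<in> carrier X" shows "nrm X (\<ominus> x) = nrm X x"
proof -
  have 1: "(1::'k) \<in> carrier scalar_ring" "(-1::'k) \<in> carrier scalar_ring"
    by (auto simp: scalar_ring_def)
  have c: "(-1::'k) \<odot> x \<in> carrier X" using smult_closed 1 x by auto
  have "(0::'k) \<odot> x = \<zero>"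
    using smult_l_null[OF x] by (simp add: scalar_ring_def)
  moreover have "(-1 + 1 :: 'k) \<odot> x = (-1::'k) \<odot> x \<oplus> (1::'k) \<odot> x"
    using smult_l_distr[OF 1(2,1) x] by (simp add: scalar_ring_def)
  moreover have "(1::'k) \<odot> x = x"
    using smult_one[OF x] by (simp add: scalar_ring_def)
  ultimately have "(-1::'k) \<odot> x \<oplus> x = \<zero>" by simp
  hence "\<ominus> x = (-1::'k) \<odot> x" using c x minus_equality by blast
  thus ?thesis using nrm_smult[OF x] by simp
qed

lemma normed_space_Metric_space:
  assumes "normed_space X"
  shows "Metric_space (carrier X) (nrm_dist X)"
proof -
  interpret normed_space X by fact
  show ?thesis
  proof
    fix x y
    show "0 \<le> nrm_dist X x y" by (simp add: nrm_dist_def nrm_nonneg)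
    show "nrm_dist X x y = nrm_dist X y x"
    proof (cases "x \<in> carrier X \<and> y \<in> carrier X")
      case True
      hence "x \<ominus>\<^bsub>X\<^esub> y = \<ominus>\<^bsub>X\<^esub> (y \<ominus>\<^bsub>X\<^esub> x)"
        by (simp add: a_minus_def M.minus_add M.a_comm)
      thus ?thesis using True by (simp add: nrm_dist_def nrm_minus)
    qed (auto simp: nrm_dist_def)
  next
    fix x y assume "x \<in> carrier X" "y \<in> carrier X"
    moreover from this have "x \<ominus>\<^bsub>X\<^esub> y = \<zero>\<^bsub>X\<^esub> \<longleftrightarrow> x = y"
      by (metis a_minus_def M.a_inv_closed M.minus_equality M.minus_minus M.r_neg)
    ultimately show "nrm_dist X x y = 0 \<longleftrightarrow> x = y"
      by (simp add: nrm_dist_def nrm_eq_0)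
  next
    fix x y z assume c: "x \<in> carrier X" "y \<in> carrier X" "z \<in> carrier X"
    hence "x \<ominus>\<^bsub>X\<^esub> z = (x \<ominus>\<^bsub>X\<^esub> y) \<oplus>\<^bsub>X\<^esub> (y \<ominus>\<^bsub>X\<^esub> z)"
      by (simp add: a_minus_def M.a_assoc M.r_neg1 M.r_neg2)
    thus "nrm_dist X x z \<le> nrm_dist X x y + nrm_dist X y z"
      using c nrm_triangle[of "x \<ominus>\<^bsub>X\<^esub> y" "y \<ominus>\<^bsub>X\<^esub> z"] by (simp add: nrm_dist_def)
  qed
qed

end

theory Submission
  imports Defs
begin

text \<open>
  A space is BFU if and only if the following holds for norm bounded sets \<open>G\<close> of functionals: a
  functional that \<open>G\<close> approximates on finite sets of vectors is the pointwise limit of a sequence in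
  \<open>G\<close>. This property is inherited by images under bounded linear surjections, because functionals
  can be pulled back; quotients, complemented subspaces and regrouped products are such images.
  In a separable space it suffices to converge on a countable dense set. A reflexive space, and
  likewise a finite product of reflexive spaces, has a compact absorbing set on which all
  functionals are continuous, while every dual ball is compact by Alaoglu's theorem; a pointwise compact
  set of continuous functions on a compact space is a Frechet-Urysohn space. The product of a
  separable space and a BFU space is treated by perturbing functionals so that
  convergence in the second factor forces convergence in the first.
\<close>

section \<open>Pointwise convergence on compact spaces\<close>

text \<open>A pointwise closure is in general not reached by sequences, so every case needs a
  reduction to countably many conditions. In a separable space a dense set of vectors supplies them.
  In a reflexive space no fixed countable set of vectors need suffice. There, compactness in the
  vector variable first shrinks \<open>G\<close> to a countable \<open>H\<close> that still
  approximates the limit. Countably many functions see the vectors only through a separable metric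
  space, so some countable set of vectors is dense as far as \<open>H\<close> can tell. Compactness
  in the functional variable then turns convergence on that set into convergence everywhere. The two
  variables thus play different roles, and both must be compact. Products are delicate because a
  sequence found for one factor says nothing about the other, and the shift argument relies on one
  factor being separable. A mixed finite product is therefore regrouped into one separable and one
  reflexive block, and that argument is applied once. The reflexive block is handled through the
  product of the compact sets of its factors.\<close>

definition adherent :: "'a set \<Rightarrow> ('a \<Rightarrow> 'k::metric_space) set \<Rightarrow> ('a \<Rightarrow> 'k) \<Rightarrow> bool" where
  "adherent S G t \<longleftrightarrow>
     (\<forall>F e. finite F \<longrightarrow> F \<subseteq> S \<longrightarrow> 0 < e \<longrightarrow> (\<exists>g\<in>G. \<forall>x\<in>F. dist (g x) (t x) < e))"

definition seq_adherent :: "'a set \<Rightarrow> ('a \<Rightarrow> 'k::metric_space) set \<Rightarrow> ('a \<Rightarrow> 'k) \<Rightarrow> bool" where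
  "seq_adherent S G t \<longleftrightarrow>
     (\<exists>s :: nat \<Rightarrow> 'a \<Rightarrow> 'k. range s \<subseteq> G \<and> (\<forall>x\<in>S. (\<lambda>n. s n x) \<longlonglongrightarrow> t x))"

lemma adherentD:
  "adherent S G t \<Longrightarrow> finite F \<Longrightarrow> F \<subseteq> S \<Longrightarrow> 0 < e \<Longrightarrow> \<exists>g\<in>G. \<forall>x\<in>F. dist (g x) (t x) < e"
  by (simp add: adherent_def)

text \<open>Basic open sets restrict finitely many coordinates, and for finitely many coordinates
  one common radius suffices. This makes \<open>adherent\<close> the closure for pointwise
  convergence, expressed without the extensionality that points of the product topology must
  satisfy.\<close>

lemma closure_of_product_euclidean:
  fixes t :: "'a \<Rightarrow> 'k::metric_space"
  assumes G: "G \<subseteq> extensional S" and t: "t \<in> extensional S"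
  shows "t \<in> product_topology (\<lambda>_. euclidean) S closure_of G \<longleftrightarrow> adherent S G t"
proof
  assume L: "t \<in> product_topology (\<lambda>_. euclidean) S closure_of G"
  show "adherent S G t"
    unfolding adherent_def
  proof (intro allI impI)
    fix F e assume F: "finite F" "F \<subseteq> S" "0 < (e::real)"
    let ?U = "\<Pi>\<^sub>E i\<in>S. if i \<in> F then ball (t i) e else UNIV"
    have "{i. (if i \<in> F then ball (t i) e else UNIV) \<noteq> UNIV} \<subseteq> F" by auto
    then have "openin (product_topology (\<lambda>_. euclidean) S) ?U"
      using F by (intro product_topology_basis) (auto intro: finite_subset)
    moreover have "t \<in> ?U" using t F by (auto simp: PiE_def)
    ultimately obtain g where "g \<in> G" "g \<in> ?U" using L by (auto simp: in_closure_of)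
    moreover from this have "\<forall>x\<in>F. dist (g x) (t x) < e"
      using F by (auto simp: PiE_def Pi_def dist_commute subset_eq)
    ultimately show "\<exists>g\<in>G. \<forall>x\<in>F. dist (g x) (t x) < e" by blast
  qed
next
  assume ad: "adherent S G t"
  show "t \<in> product_topology (\<lambda>_. euclidean) S closure_of G"
    unfolding in_closure_of
  proof (intro conjI allI impI)
    show "t \<in> topspace (product_topology (\<lambda>_. euclidean) S)" using t by (simp add: PiE_def)
    fix U assume "t \<in> U \<and> openin (product_topology (\<lambda>_. euclidean) S) U"
    then obtain X where X: "t \<in> PiE S X" "\<And>i. open (X i)" "finite {i. X i \<noteq> UNIV}" "PiE S X \<subseteq> U"
      using product_topology_open_contains_basis[of "\<lambda>_. euclidean" S U t] by auto
    let ?F = "{i \<in> S. X i \<noteq> UNIV}"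
    have fin: "finite ?F" using X(3) by (rule rev_finite_subset) auto
    have "\<forall>i\<in>?F. \<exists>e>0. ball (t i) e \<subseteq> X i"
      using X(1,2) by (auto simp: open_contains_ball PiE_def Pi_def)
    then obtain e where e: "\<And>i. i \<in> ?F \<Longrightarrow> 0 < e i \<and> ball (t i) (e i) \<subseteq> X i" by metis
    \<comment> \<open>The inserted 1 keeps the minimum defined when no coordinate is
      restricted.\<close>
    let ?e = "Min (insert 1 (e ` ?F))"
    have "0 < ?e" using fin e by (subst Min_gr_iff) auto
    then obtain g where g: "g \<in> G" "\<forall>x\<in>?F. dist (g x) (t x) < ?e"
      using adherentD[OF ad fin] by blast
    have "g x \<in> X x" if "x \<in> S" for x
    proof (cases "X x = UNIV")
      case False
      then have x: "x \<in> ?F" using that by simp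
      have "?e \<le> e x" by (rule Min_le) (use fin x in auto)
      then have "g x \<in> ball (t x) (e x)" using g(2) x by (force simp: dist_commute)
      then show ?thesis using e[OF x] by auto
    qed simp
    then have "g \<in> PiE S X" using g(1) G by (auto simp: PiE_def)
    then show "\<exists>y. y \<in> G \<and> y \<in> U" using g(1) X(4) by blast
  qed
qed

text \<open>A diagonal choice: the function with index \<open>n\<close> is within
  \<open>1 / (n + 1)\<close> of \<open>t\<close> on the finitely many points of \<open>D\<close>
  numbered up to \<open>n\<close>, so each point is controlled from its own number on.\<close>

lemma adherent_countable_seq:
  fixes t :: "'a \<Rightarrow> 'k::metric_space"
  assumes ad: "adherent S G t" and D: "countable D" "D \<subseteq> S"
  shows "seq_adherent D G t"
proof -
  obtain f :: "'a \<Rightarrow> nat" where f: "inj_on f D" using D(1) by (rule countableE)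
  let ?D = "\<lambda>n. {d \<in> D. f d \<le> n}"
  have fin: "finite (?D n)" for n
    by (rule finite_imageD[of f]) (auto intro: finite_subset[of _ "{..n}"] inj_on_subset[OF f])
  have "\<exists>g\<in>G. \<forall>x\<in>?D n. dist (g x) (t x) < inverse (real (Suc n))" for n
    by (rule adherentD[OF ad fin]) (use D(2) in auto)
  then obtain s where s: "\<And>n. s n \<in> G" "\<And>n x. x \<in> ?D n \<Longrightarrow> dist (s n x) (t x) < inverse (real (Suc n))"
    by metis
  have "(\<lambda>n. s n d) \<longlonglongrightarrow> t d" if "d \<in> D" for d
    unfolding tendsto_dist_iff[of _ "t d"]
  proof (rule Lim_null_comparison[OF _ LIMSEQ_inverse_real_of_nat])
    show "\<forall>\<^sub>F n in sequentially. norm (dist (s n d) (t d)) \<le> inverse (real (Suc n))"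
      using eventually_ge_at_top[of "f d"] by eventually_elim (use s(2) that in \<open>auto intro!: less_imp_le\<close>)
  qed
  then show ?thesis using s(1) by (auto simp: seq_adherent_def)
qed

lemma continuous_map_dist:
  fixes f g :: "'a \<Rightarrow> 'k::metric_space"
  assumes "continuous_map X euclidean f" "continuous_map X euclidean g"
  shows "continuous_map X euclideanreal (\<lambda>x. dist (f x) (g x))"
proof -
  have "continuous_map X (prod_topology euclidean euclidean) (\<lambda>x. (f x, g x))"
    by (rule continuous_map_pairedI[OF assms])
  moreover have "continuous_map (prod_topology euclidean euclidean) euclideanreal
      (\<lambda>p :: 'k \<times> 'k. dist (fst p) (snd p))"
    unfolding euclidean_product_topology by (auto intro!: continuous_intros)
  ultimately have "continuous_map X euclideanreal ((\<lambda>p. dist (fst p) (snd p)) \<circ> (\<lambda>x. (f x, g x)))"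
    by (rule continuous_map_compose)
  then show ?thesis by (simp add: o_def)
qed

lemma openin_dist_less:
  "continuous_map X euclidean f \<Longrightarrow> continuous_map X euclidean g \<Longrightarrow>
    openin X {x \<in> topspace X. dist (f x) (g x) < e}"
  using openin_continuous_map_preimage[OF continuous_map_dist, of X f g "{..<e}"] by simp

lemma closedin_dist_le:
  "continuous_map X euclidean f \<Longrightarrow> continuous_map X euclidean g \<Longrightarrow>
    closedin X {x \<in> topspace X. dist (f x) (g x) \<le> e}"
  using closedin_continuous_map_preimage[OF continuous_map_dist, of X f g "{..e}"] by simp

lemma closedin_dist_ge:
  "continuous_map X euclidean f \<Longrightarrow> continuous_map X euclidean g \<Longrightarrow>
    closedin X {x \<in> topspace X. e \<le> dist (f x) (g x)}"
  using closedin_continuous_map_preimage[OF continuous_map_dist, of X f g "{e..}"] by simp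

lemma closedin_equal:
  "continuous_map X euclidean f \<Longrightarrow> continuous_map X euclidean g \<Longrightarrow>
    closedin X {x \<in> topspace X. f x = (g x :: 'k::metric_space)}"
  using closedin_dist_le[of X f g 0] by simp

text \<open>The finite intersection property in the form in which it is applied below: one
  distinguished closed set \<open>E\<close> is met in the presence of any finitely many of the
  remaining conditions.\<close>

lemma compact_fip:
  assumes T: "compact_space T" and E: "closedin T E" and C: "\<And>j. j \<in> J \<Longrightarrow> closedin T (C j)"
    and fip: "\<And>I. finite I \<Longrightarrow> I \<subseteq> J \<Longrightarrow> E \<inter> (\<Inter>j\<in>I. C j) \<noteq> {}"
  shows "E \<inter> (\<Inter>j\<in>J. C j) \<noteq> {}"
proof -
  have "\<Inter>\<F> \<noteq> {}" if \<F>: "finite \<F>" "\<F> \<subseteq> insert E (C ` J)" for \<F>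
  proof -
    have "finite (\<F> - {E})" "\<F> - {E} \<subseteq> C ` J" using \<F> by auto
    then obtain I where I: "I \<subseteq> J" "finite I" "\<F> - {E} = C ` I"
      using finite_subset_image by meson
    then have "E \<inter> (\<Inter>j\<in>I. C j) \<subseteq> \<Inter>\<F>" by blast
    then show ?thesis using fip[OF I(2,1)] by blast
  qed
  then have "\<Inter>(insert E (C ` J)) \<noteq> {}"
    using E C by (intro T[unfolded compact_space_fip, rule_format]) auto
  then show ?thesis by simp
qed

section \<open>Countability reductions and limits of sequences on compact spaces\<close>

text \<open>Compactness of the finite powers of the space gives countable tightness of the topology of
  pointwise convergence (Arhangel'skii).\<close>

lemma adherent_countable_subset:
  fixes t :: "'a \<Rightarrow> 'k::metric_space"
  assumes T: "compact_space T" and cont: "\<And>g. g \<in> insert t G \<Longrightarrow> continuous_map T euclidean g"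
    and ad: "adherent (topspace T) G t"
  obtains H where "countable H" "H \<subseteq> G" "adherent (topspace T) H t"
proof -
  \<comment> \<open>For each \<open>g\<close> the tuples at whose entries \<open>g\<close> is close
    to \<open>t\<close> form an open set. Adherence, applied to the finite set of entries of a
    tuple, says that these sets cover the compact power.\<close>
  have "\<exists>A. finite A \<and> A \<subseteq> G \<and> (\<forall>x \<in> {..<n} \<rightarrow>\<^sub>E topspace T.
      \<exists>g\<in>A. \<forall>i<n. dist (g (x i)) (t (x i)) < inverse (real (Suc n)))" for n :: nat
  proof -
    let ?P = "product_topology (\<lambda>_. T) {..<n}"
    let ?e = "inverse (real (Suc n))"
    let ?U = "\<lambda>g. {x \<in> topspace ?P. \<forall>i<n. dist (g (x i)) (t (x i)) < ?e}"
    have comp: "compact_space ?P" using T by (simp add: compact_space_product_topology)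
    have op: "openin ?P (?U g)" if g: "g \<in> G" for g
    proof -
      have "openin ?P {x \<in> topspace ?P. dist (g (x i)) (t (x i)) < ?e}" if "i < n" for i
      proof (rule openin_dist_less)
        have i: "continuous_map ?P T (\<lambda>x. x i)"
          using that by (intro continuous_map_product_projection) auto
        show "continuous_map ?P euclidean (\<lambda>x. g (x i))" "continuous_map ?P euclidean (\<lambda>x. t (x i))"
          using continuous_map_compose[OF i cont[of g]] continuous_map_compose[OF i cont[of t]] g
          by (simp_all add: o_def)
      qed
      then have "openin ?P ((\<Inter>i\<in>{..<n}. {x \<in> topspace ?P. dist (g (x i)) (t (x i)) < ?e}) \<inter> topspace ?P)"
        by (intro openin_INT) auto
      moreover have "(\<Inter>i\<in>{..<n}. {x \<in> topspace ?P. dist (g (x i)) (t (x i)) < ?e}) \<inter> topspace ?P = ?U g"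
        by auto
      ultimately show ?thesis by simp
    qed
    have "topspace ?P \<subseteq> \<Union>(?U ` G)"
    proof
      fix x assume x: "x \<in> topspace ?P"
      then have "x ` {..<n} \<subseteq> topspace T" by auto
      then obtain g where "g \<in> G" "\<forall>y \<in> x ` {..<n}. dist (g y) (t y) < ?e"
        using adherentD[OF ad, of "x ` {..<n}" ?e] by auto
      then show "x \<in> \<Union>(?U ` G)" using x by auto
    qed
    then obtain \<F> where \<F>: "finite \<F>" "\<F> \<subseteq> ?U ` G" "topspace ?P \<subseteq> \<Union>\<F>"
      using comp[unfolded compact_space_alt, rule_format, of "?U ` G"] op by blast
    then obtain A where A: "A \<subseteq> G" "finite A" "\<F> = ?U ` A"
      using finite_subset_image by meson
    show ?thesis
    proof (intro exI[of _ A] conjI ballI)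
      fix x assume "x \<in> {..<n} \<rightarrow>\<^sub>E topspace T"
      then have "x \<in> \<Union>\<F>" using \<F>(3) by auto
      then show "\<exists>g\<in>A. \<forall>i<n. dist (g (x i)) (t (x i)) < ?e" unfolding A(3) by auto
    qed (use A in auto)
  qed
  then obtain A where A: "\<And>n. finite (A n)" "\<And>n. A n \<subseteq> G"
    "\<And>n x. x \<in> {..<n} \<rightarrow>\<^sub>E topspace T \<Longrightarrow>
      \<exists>g\<in>A n. \<forall>i<n. dist (g (x i)) (t (x i)) < inverse (real (Suc n))"
    by metis
  show thesis
  proof (rule that[of "\<Union>n. A n"])
    show "countable (\<Union>n. A n)" using A(1) by (auto intro: countable_finite)
    show "(\<Union>n. A n) \<subseteq> G" using A(2) by blast
    show "adherent (topspace T) (\<Union>n. A n) t"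
      unfolding adherent_def
    proof (intro allI impI)
      fix F and e :: real assume F: "finite F" "F \<subseteq> topspace T" "0 < e"
      obtain k where k: "inverse (real (Suc k)) < e" using F(3) reals_Archimedean by blast
      obtain xs where xs: "set xs = F" using F(1) finite_list by blast
      show "\<exists>g\<in>\<Union>n. A n. \<forall>x\<in>F. dist (g x) (t x) < e"
      proof (cases "F = {}")
        case True
        \<comment> \<open>The empty tuple is the only element of the power with exponent 0, and the
          property of \<open>A 0\<close> at this tuple yields an element.\<close>
        have "A 0 \<noteq> {}" using A(3)[of "\<lambda>_. undefined" 0] by auto
        then show ?thesis using True by auto
      next
        case False
        \<comment> \<open>Large enough both to list all of \<open>F\<close> and to reach the
          precision \<open>1 / (k + 1)\<close>. Positions beyond the list repeat its first
          entry.\<close>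
        define n where "n = length xs + k"
        define x where "x = (\<lambda>i\<in>{..<n}. xs ! (if i < length xs then i else 0))"
        have "x \<in> {..<n} \<rightarrow>\<^sub>E topspace T"
        proof -
          have "xs \<noteq> []" using xs False by auto
          then have "xs ! (if i < length xs then i else 0) \<in> F" for i using xs by auto
          then show ?thesis using F(2) by (force simp: x_def)
        qed
        then obtain g where g: "g \<in> A n" "\<And>i. i < n \<Longrightarrow> dist (g (x i)) (t (x i)) < inverse (real (Suc n))"
          using A(3) by blast
        have "dist (g y) (t y) < e" if y: "y \<in> F" for y
        proof -
          obtain i where i: "i < length xs" "xs ! i = y" using y xs by (auto simp: in_set_conv_nth)
          then have "x i = y" "i < n" by (auto simp: x_def n_def)
          then have "dist (g y) (t y) < inverse (real (Suc n))" using g(2) by blast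
          also have "\<dots> \<le> inverse (real (Suc k))" by (simp add: n_def field_simps)
          finally show ?thesis using k by simp
        qed
        then show ?thesis using g(1) by blast
      qed
    qed
  qed
qed

text \<open>Listing the values of all functions of \<open>H\<close> at a point maps \<open>K\<close>
  into a countable power of the scalars. This power is second countable, so the image is separable,
  and preimages of a countable dense subset of the image form \<open>D\<close>.\<close>

lemma countable_dense_wrt_functions:
  fixes H :: "('a \<Rightarrow> 'k::{metric_space, second_countable_topology}) set"
  assumes H: "countable H"
  obtains D where "countable D" "D \<subseteq> K"
    "\<And>x F e. x \<in> K \<Longrightarrow> finite F \<Longrightarrow> F \<subseteq> H \<Longrightarrow> 0 < e \<Longrightarrow> \<exists>d\<in>D. \<forall>g\<in>F. dist (g d) (g x) < e"
proof -
  \<comment> \<open>One additional function makes the enumerated set nonempty. It can only make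
    approximation harder, so the conclusion for \<open>H\<close> is unaffected.\<close>
  define g where "g = from_nat_into (insert undefined H)"
  have g: "range g = insert undefined H"
    unfolding g_def by (rule range_from_nat_into) (use H in auto)
  let ?\<Phi> = "\<lambda>x i. g i x"
  obtain Q where Q: "countable Q" "Q \<subseteq> ?\<Phi> ` K" "?\<Phi> ` K \<subseteq> closure Q"
    by (rule separable)
  obtain D where D: "countable D" "D \<subseteq> K" "Q = ?\<Phi> ` D"
    using Q(1,2) countable_subset_image by meson
  show thesis
  proof (rule that[OF D(1,2)])
    fix x F and e :: real assume x: "x \<in> K" and F: "finite F" "F \<subseteq> H" "0 < e"
    then obtain N where N: "finite N" "F = g ` N"
      using finite_subset_image[of F g UNIV] g by auto
    let ?U = "\<Inter>i\<in>N. {z. dist (z i) (g i x) < e}"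
    have "open ?U"
      using N(1) by (intro open_INT) (auto intro!: open_Collect_less continuous_intros)
    moreover have "?\<Phi> x \<in> ?U" using F by simp
    moreover have "?\<Phi> x \<in> closure (?\<Phi> ` D)" using Q(3) D(3) x by auto
    ultimately have "?U \<inter> ?\<Phi> ` D \<noteq> {}"
      using open_Int_closure_eq_empty[of ?U "?\<Phi> ` D"] by blast
    then show "\<exists>d\<in>D. \<forall>g\<in>F. dist (g d) (g x) < e" using N(2) by auto
  qed
qed

text \<open>The set \<open>D\<close> is dense only for the topology generated by \<open>H\<close>,
  whereas \<open>h\<close> and \<open>t\<close> are continuous for the possibly finer topology of
  \<open>T\<close>. Compactness bridges the gap: it yields a point \<open>y\<close> with
  \<open>h y = t y\<close> that no function of \<open>H\<close> distinguishes from \<open>x\<close>,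
  and \<open>resp\<close> moves the equality from \<open>y\<close> to \<open>x\<close>.\<close>

lemma eq_on_compact_if_eq_on_dense:
  fixes h t :: "'a \<Rightarrow> 'k::metric_space"
  assumes T: "compact_space T"
    and cont: "\<And>g. g \<in> insert h (insert t H) \<Longrightarrow> continuous_map T euclidean g"
    and resp: "\<And>x y f. x \<in> topspace T \<Longrightarrow> y \<in> topspace T \<Longrightarrow> f \<in> {h, t} \<Longrightarrow>
      (\<forall>g\<in>H. g x = g y) \<Longrightarrow> f x = f y"
    and D: "D \<subseteq> topspace T" "\<And>x F e. x \<in> topspace T \<Longrightarrow> finite F \<Longrightarrow> F \<subseteq> H \<Longrightarrow> 0 < e \<Longrightarrow>
      \<exists>d\<in>D. \<forall>g\<in>F. dist (g d) (g x) < e"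
    and eq: "\<And>d. d \<in> D \<Longrightarrow> h d = t d" and x: "x \<in> topspace T"
  shows "h x = t x"
proof -
  let ?E = "{y \<in> topspace T. h y = t y}"
  let ?C = "\<lambda>(g, n). {y \<in> topspace T. dist (g y) (g x) \<le> inverse (real (Suc n))}"
  have "?E \<inter> (\<Inter>j \<in> H \<times> UNIV. ?C j) \<noteq> {}"
  proof (rule compact_fip[OF T])
    show "closedin T ?E" using cont by (intro closedin_equal) auto
    show "closedin T (?C j)" if "j \<in> H \<times> UNIV" for j
      using that cont by (auto intro!: closedin_dist_le)
    fix I :: "(('a \<Rightarrow> 'k) \<times> nat) set" assume I: "finite I" "I \<subseteq> H \<times> UNIV"
    then have fst_I: "fst ` I \<subseteq> H" by auto
    \<comment> \<open>The finest of the finitely many precisions serves all constraints at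
      once.\<close>
    let ?N = "Max (insert 0 (snd ` I))"
    obtain d where d: "d \<in> D" "\<forall>g \<in> fst ` I. dist (g d) (g x) < inverse (real (Suc ?N))"
      using D(2)[OF x, of "fst ` I" "inverse (real (Suc ?N))"] I(1) fst_I by auto
    have "d \<in> ?C j" if j: "j \<in> I" for j
    proof -
      have "snd j \<le> ?N" using I(1) j by (intro Max_ge) auto
      then have "inverse (real (Suc ?N)) \<le> inverse (real (Suc (snd j)))" by (simp add: field_simps)
      moreover have "dist (fst j d) (fst j x) < inverse (real (Suc ?N))" using d(2) j by blast
      ultimately have "dist (fst j d) (fst j x) \<le> inverse (real (Suc (snd j)))" by linarith
      then show ?thesis using d(1) D(1) by (auto simp: case_prod_beta)
    qed
    then show "?E \<inter> (\<Inter>j\<in>I. ?C j) \<noteq> {}" using d(1) D(1) eq by blast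
  qed
  then obtain y where y: "y \<in> topspace T" "h y = t y"
    "\<And>g n. g \<in> H \<Longrightarrow> dist (g y) (g x) \<le> inverse (real (Suc n))"
    by fastforce
  have "g y = g x" if "g \<in> H" for g
    using y(3)[OF that] reals_Archimedean[of "dist (g y) (g x)"] zero_less_dist_iff
    by (metis not_less)
  then show ?thesis using resp[OF y(1) x] y(2) by (metis insertCI)
qed

text \<open>After the reductions to countable \<open>H\<close> and \<open>D\<close>, some sequence
  in \<open>H\<close> converges to \<open>t\<close> on \<open>D\<close>. If it failed at a point
  \<open>x\<close>, compactness of \<open>L\<close> would give a function \<open>h\<close> that
  equals \<open>t\<close> on \<open>D\<close>, differs from \<open>t\<close> at \<open>x\<close>,
  and identifies all points that \<open>H\<close> identifies. Compactness of \<open>K\<close>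
  excludes this.\<close>

lemma seq_adherent_if_compact:
  fixes t :: "'a \<Rightarrow> 'k::{metric_space, second_countable_topology}"
  assumes K: "compact_space K" and L: "compact_space L"
    and contK: "\<And>f. f \<in> topspace L \<Longrightarrow> continuous_map K euclidean f"
    and contL: "\<And>x. x \<in> topspace K \<Longrightarrow> continuous_map L euclidean (\<lambda>f. f x)"
    and G: "G \<subseteq> topspace L" and t: "t \<in> topspace L" and ad: "adherent (topspace K) G t"
  shows "seq_adherent (topspace K) G t"
proof -
  obtain H where H: "countable H" "H \<subseteq> G" "adherent (topspace K) H t"
    using adherent_countable_subset[OF K _ ad] contK G t by blast
  obtain D where D: "countable D" "D \<subseteq> topspace K"
    "\<And>x F e. x \<in> topspace K \<Longrightarrow> finite F \<Longrightarrow> F \<subseteq> H \<Longrightarrow> 0 < e \<Longrightarrow>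
      \<exists>d\<in>D. \<forall>g\<in>F. dist (g d) (g x) < e"
    using countable_dense_wrt_functions[OF H(1), of "topspace K"] by blast
  obtain s where s: "\<And>n. s n \<in> H" "\<And>d. d \<in> D \<Longrightarrow> (\<lambda>n. s n d) \<longlonglongrightarrow> t d"
    using adherent_countable_seq[OF H(3) D(1,2)] by (auto simp: seq_adherent_def)
  \<comment> \<open>Pairs of points that \<open>H\<close> cannot separate. The limit
    \<open>t\<close> cannot separate them either, since one \<open>g\<close> in \<open>H\<close>
    approximates it at both points within half of any supposed gap.\<close>
  let ?R = "{(y, z). y \<in> topspace K \<and> z \<in> topspace K \<and> (\<forall>g\<in>H. g y = g z)}"
  have t_resp: "t y = t z" if "(y, z) \<in> ?R" for y z
  proof (rule ccontr)
    assume "t y \<noteq> t z"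
    then have "0 < dist (t y) (t z) / 2" by simp
    moreover have "{y, z} \<subseteq> topspace K" using that by simp
    ultimately obtain g
      where "g \<in> H" "dist (g y) (t y) < dist (t y) (t z) / 2" "dist (g z) (t z) < dist (t y) (t z) / 2"
      using adherentD[OF H(3), of "{y, z}" "dist (t y) (t z) / 2"] by blast
    moreover have "g y = g z" using that \<open>g \<in> H\<close> by auto
    ultimately show False
      using dist_triangle[of "t y" "t z" "g y"] dist_commute[of "t y" "g y"] by simp
  qed
  have "(\<lambda>n. s n x) \<longlonglongrightarrow> t x" if x: "x \<in> topspace K" for x
  proof (rule ccontr)
    assume "\<not> ?thesis"
    then obtain e where e: "0 < e" "\<exists>\<^sub>F n in sequentially. e \<le> dist (s n x) (t x)"
      unfolding tendsto_iff by (auto simp: frequently_def not_le)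
    let ?A = "{h \<in> topspace L. e \<le> dist (h x) (t x)}"
    let ?E = "\<Inter>(insert ?A ((\<lambda>(y, z). {h \<in> topspace L. h y = h z}) ` ?R))"
    let ?C = "\<lambda>(d, n). {h \<in> topspace L. dist (h d) (t d) \<le> inverse (real (Suc n))}"
    \<comment> \<open>Some term of the sequence meets any finite choice of the conditions:
      infinitely many terms are bad at \<open>x\<close>, and from some index on all terms satisfy
      the chosen conditions at points of \<open>D\<close>.\<close>
    have "?E \<inter> (\<Inter>j \<in> D \<times> UNIV. ?C j) \<noteq> {}"
    proof (rule compact_fip[OF L])
      show "closedin L ?E"
        using contL x by (intro closedin_Inter) (auto intro!: closedin_dist_ge closedin_equal)
      show "closedin L (?C j)" if "j \<in> D \<times> UNIV" for j
        using that contL D(2) by (auto intro!: closedin_dist_le)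
      fix I :: "('a \<times> nat) set" assume I: "finite I" "I \<subseteq> D \<times> UNIV"
      have "\<forall>j\<in>I. \<forall>\<^sub>F n in sequentially. dist (s n (fst j)) (t (fst j)) < inverse (real (Suc (snd j)))"
      proof
        fix j assume "j \<in> I"
        then have "(\<lambda>n. s n (fst j)) \<longlonglongrightarrow> t (fst j)" using I s(2) by auto
        then show "\<forall>\<^sub>F n in sequentially. dist (s n (fst j)) (t (fst j)) < inverse (real (Suc (snd j)))"
          by (rule tendstoD) simp
      qed
      then have "\<forall>\<^sub>F n in sequentially.
          \<forall>j\<in>I. dist (s n (fst j)) (t (fst j)) < inverse (real (Suc (snd j)))"
        by (rule eventually_ball_finite[OF I(1)])
      then obtain n where n: "e \<le> dist (s n x) (t x)"
        "\<forall>j\<in>I. dist (s n (fst j)) (t (fst j)) < inverse (real (Suc (snd j)))"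
        using frequently_ex[OF frequently_eventually_conj[OF e(2)]] by blast
      have "s n \<in> topspace L" "s n \<in> H" using s(1) H(2) G by auto
      then have "s n \<in> ?E \<inter> (\<Inter>j\<in>I. ?C j)" using n by (auto simp: less_imp_le)
      then show "?E \<inter> (\<Inter>j\<in>I. ?C j) \<noteq> {}" by blast
    qed
    then obtain h where "h \<in> ?E" and hC: "h \<in> (\<Inter>j \<in> D \<times> UNIV. ?C j)" by blast
    then have h: "h \<in> topspace L" "e \<le> dist (h x) (t x)" "\<And>y z. (y, z) \<in> ?R \<Longrightarrow> h y = h z" by auto
    have hD: "h d = t d" if d: "d \<in> D" for d
    proof -
      have "dist (h d) (t d) \<le> inverse (real (Suc n))" for n using hC d by auto
      then show ?thesis
        using reals_Archimedean[of "dist (h d) (t d)"] zero_less_dist_iff by (metis not_less)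
    qed
    have "h x = t x"
    proof (rule eq_on_compact_if_eq_on_dense[OF K, of h t H D])
      show "continuous_map K euclidean g" if "g \<in> insert h (insert t H)" for g
        using that h(1) t G H(2) contK by auto
      show "f y = f z" if "y \<in> topspace K" "z \<in> topspace K" "f \<in> {h, t}" "\<forall>g\<in>H. g y = g z" for y z f
        using that h(3)[of y z] t_resp[of y z] by auto
    qed (use D x hD in auto)
    then show False using h(2) e(1) by simp
  qed
  moreover have "range s \<subseteq> G" using s(1) H(2) by blast
  ultimately show ?thesis unfolding seq_adherent_def by blast
qed

section \<open>Normed spaces and functionals\<close>

lemma scalar_ring_simps [simp]:
  "carrier scalar_ring = UNIV" "zero scalar_ring = 0" "one scalar_ring = 1"
  "add scalar_ring a b = a + b" "monoid.mult scalar_ring a b = a * b"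
  by (simp_all add: scalar_ring_def)

lemma scalar_space_simps [simp]:
  "carrier scalar_space = UNIV" "add scalar_space a b = a + b"
  "smult scalar_space a b = a * b" "nrm scalar_space a = norm a"
  by (simp_all add: scalar_space_def)

lemma cring_scalar_ring: "cring (scalar_ring :: 'k::{real_normed_field, euclidean_space} ring)"
proof (rule cringI)
  show "abelian_group (scalar_ring :: 'k ring)"
    by (rule abelian_groupI) (auto intro: exI[of _ "- _"] simp: algebra_simps)
  show "comm_monoid (scalar_ring :: 'k ring)"
    by (rule comm_monoidI) (auto simp: algebra_simps)
qed (auto simp: algebra_simps)

text \<open>The neutral law and the inverses of the additive group are derived from multiplication
  by 0 and by -1.\<close>

lemma normed_spaceI:
  fixes X :: "('k::{real_normed_field, euclidean_space}, 'a) normed_module" (structure)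
  assumes add_closed: "\<And>x y. x \<in> carrier X \<Longrightarrow> y \<in> carrier X \<Longrightarrow> x \<oplus> y \<in> carrier X"
    and zero_closed: "\<zero> \<in> carrier X"
    and smult_closed: "\<And>c x. x \<in> carrier X \<Longrightarrow> c \<odot> x \<in> carrier X"
    and a_assoc: "\<And>x y z. x \<in> carrier X \<Longrightarrow> y \<in> carrier X \<Longrightarrow> z \<in> carrier X \<Longrightarrow>
      x \<oplus> y \<oplus> z = x \<oplus> (y \<oplus> z)"
    and a_comm: "\<And>x y. x \<in> carrier X \<Longrightarrow> y \<in> carrier X \<Longrightarrow> x \<oplus> y = y \<oplus> x"
    and smult_0: "\<And>x. x \<in> carrier X \<Longrightarrow> 0 \<odot> x = \<zero>"
    and smult_1: "\<And>x. x \<in> carrier X \<Longrightarrow> 1 \<odot> x = x"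
    and l_distr: "\<And>c d x. x \<in> carrier X \<Longrightarrow> (c + d) \<odot> x = c \<odot> x \<oplus> d \<odot> x"
    and r_distr: "\<And>c x y. x \<in> carrier X \<Longrightarrow> y \<in> carrier X \<Longrightarrow> c \<odot> (x \<oplus> y) = c \<odot> x \<oplus> c \<odot> y"
    and smult_assoc: "\<And>c d x. x \<in> carrier X \<Longrightarrow> (c * d) \<odot> x = c \<odot> (d \<odot> x)"
    and nrm_0: "\<And>x. x \<in> carrier X \<Longrightarrow> nrm X x = 0 \<longleftrightarrow> x = \<zero>"
    and nrm_smult: "\<And>c x. x \<in> carrier X \<Longrightarrow> nrm X (c \<odot> x) = norm c * nrm X x"
    and nrm_add: "\<And>x y. x \<in> carrier X \<Longrightarrow> y \<in> carrier X \<Longrightarrow> nrm X (x \<oplus> y) \<le> nrm X x + nrm X y"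
  shows "normed_space X"
proof -
  have "abelian_group X"
  proof (rule abelian_groupI)
    show "\<zero> \<oplus> x = x" if "x \<in> carrier X" for x
      using l_distr[OF that, of 0 1] that by (simp add: smult_0 smult_1)
    show "\<exists>y\<in>carrier X. y \<oplus> x = \<zero>" if "x \<in> carrier X" for x
      using l_distr[OF that, of "-1" 1] that smult_closed[OF that, of "-1"]
      by (auto simp: smult_0 smult_1)
  qed (use assms in auto)
  then have "Module.module (scalar_ring :: 'k ring) X"
    by (intro moduleI cring_scalar_ring) (use assms in auto)
  then show ?thesis
    by (intro normed_space.intro normed_space_axioms.intro) (use assms in auto)
qed

context normed_space
begin

lemma smult_in [simp, intro]: "x \<in> carrier X \<Longrightarrow> c \<odot> x \<in> carrier X"
  using smult_closed[of c x] by simp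

lemma l_distr: "x \<in> carrier X \<Longrightarrow> (c + d) \<odot> x = c \<odot> x \<oplus> d \<odot> x"
  using smult_l_distr[of c d x] by simp

lemma r_distr: "x \<in> carrier X \<Longrightarrow> y \<in> carrier X \<Longrightarrow> c \<odot> (x \<oplus> y) = c \<odot> x \<oplus> c \<odot> y"
  using smult_r_distr[of c x y] by simp

lemma smult_assoc: "x \<in> carrier X \<Longrightarrow> (c * d) \<odot> x = c \<odot> (d \<odot> x)"
  using smult_assoc1[of c d x] by simp

lemma smult_0 [simp]: "x \<in> carrier X \<Longrightarrow> 0 \<odot> x = \<zero>"
  using smult_l_null[of x] by simp

lemma smult_1 [simp]: "x \<in> carrier X \<Longrightarrow> 1 \<odot> x = x"
  using smult_one[of x] by simp

lemma smult_zero [simp]: "c \<odot> \<zero> = \<zero>"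
  using smult_r_null[of c] by simp

lemma nrm_zero [simp]: "nrm X \<zero> = 0"
  by (simp add: nrm_eq_0)

text \<open>Linear maps are defined by sums and scalar multiples, so differences are rewritten in
  these terms before a map is applied.\<close>

lemma minus_eq: "x \<in> carrier X \<Longrightarrow> y \<in> carrier X \<Longrightarrow> x \<ominus> y = x \<oplus> (-1) \<odot> y"
proof -
  assume x: "x \<in> carrier X" and y: "y \<in> carrier X"
  have "(-1) \<odot> y \<oplus> y = \<zero>" using l_distr[OF y, of "-1" 1] y by simp
  then have "\<ominus> y = (-1) \<odot> y" using y by (intro M.minus_equality) auto
  then show "x \<ominus> y = x \<oplus> (-1) \<odot> y" by (simp add: a_minus_def)
qed

lemma diff_add_diff:
  "x \<in> carrier X \<Longrightarrow> y \<in> carrier X \<Longrightarrow> z \<in> carrier X \<Longrightarrow> (x \<ominus> y) \<oplus> (y \<ominus> z) = x \<ominus> z"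
  by (simp add: a_minus_def M.a_assoc M.r_neg1 M.r_neg2)

lemma add_diff: "x \<in> carrier X \<Longrightarrow> y \<in> carrier X \<Longrightarrow> y \<oplus> (x \<ominus> y) = x"
  by (simp add: a_minus_def M.a_lcomm M.r_neg)

lemma add_diff_cancel: "x \<in> carrier X \<Longrightarrow> y \<in> carrier X \<Longrightarrow> (x \<oplus> y) \<ominus> x = y"
  using M.a_comm[of x y] by (simp add: a_minus_def M.a_assoc M.r_neg)

lemma nrm_diff_triangle:
  "x \<in> carrier X \<Longrightarrow> y \<in> carrier X \<Longrightarrow> z \<in> carrier X \<Longrightarrow>
    nrm X (x \<ominus> z) \<le> nrm X (x \<ominus> y) + nrm X (y \<ominus> z)"
  using nrm_triangle[of "x \<ominus> y" "y \<ominus> z"] by (simp add: diff_add_diff)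

lemma nrm_diff_commute:
  "x \<in> carrier X \<Longrightarrow> y \<in> carrier X \<Longrightarrow> nrm X (x \<ominus> y) = nrm X (y \<ominus> x)"
proof -
  assume xy: "x \<in> carrier X" "y \<in> carrier X"
  then have "x \<ominus> y = \<ominus> (y \<ominus> x)"
    by (simp add: a_minus_def M.minus_add M.a_comm)
  then show ?thesis using xy by (simp add: nrm_minus)
qed

lemma Metric_space: "Metric_space (carrier X) (nrm_dist X)"
  by (rule normed_space_Metric_space) unfold_locales

end

section \<open>Bounded linear maps and balls of functionals\<close>

lemma bounded_linear_mapsD:
  assumes "T \<in> bounded_linear_maps X Y"
  shows "x \<in> carrier X \<Longrightarrow> T x \<in> carrier Y" "T \<in> extensional (carrier X)"
    "x \<in> carrier X \<Longrightarrow> y \<in> carrier X \<Longrightarrow> T (x \<oplus>\<^bsub>X\<^esub> y) = T x \<oplus>\<^bsub>Y\<^esub> T y"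
    "x \<in> carrier X \<Longrightarrow> T (c \<odot>\<^bsub>X\<^esub> x) = c \<odot>\<^bsub>Y\<^esub> T x"
  using assms by (auto simp: bounded_linear_maps_def PiE_def)

lemma bounded_linear_maps_bound:
  assumes "normed_space X" "T \<in> bounded_linear_maps X Y"
  obtains C where "0 < C" "\<And>x. x \<in> carrier X \<Longrightarrow> nrm Y (T x) \<le> C * nrm X x"
proof -
  interpret normed_space X by fact
  obtain C where C: "\<And>x. x \<in> carrier X \<Longrightarrow> nrm Y (T x) \<le> C * nrm X x"
    using assms(2) unfolding bounded_linear_maps_def by blast
  have "nrm Y (T x) \<le> (\<bar>C\<bar> + 1) * nrm X x" if "x \<in> carrier X" for x
    using C[OF that] mult_right_mono[OF _ nrm_nonneg[OF that], of C "\<bar>C\<bar> + 1"] by linarith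
  then show thesis using that[of "\<bar>C\<bar> + 1"] by simp
qed

lemma bounded_linear_maps_diff:
  assumes "normed_space X" "normed_space Y" "T \<in> bounded_linear_maps X Y"
    and "x \<in> carrier X" "y \<in> carrier X"
  shows "T (x \<ominus>\<^bsub>X\<^esub> y) = T x \<ominus>\<^bsub>Y\<^esub> T y"
proof -
  interpret X: normed_space X by fact
  interpret Y: normed_space Y by fact
  show ?thesis
    using assms(4,5) bounded_linear_mapsD[OF assms(3)] by (simp add: X.minus_eq Y.minus_eq)
qed

text \<open>For a normed space and \<open>0 \<le> C\<close> this is the closed ball of radius
  \<open>C\<close> in the dual. Stating the bound vector by vector, instead of through a supremum,
  cuts the ball out by closed conditions on finitely many values each, as Alaoglu's theorem
  requires.\<close>

definition dual_ball ::
    "('k::{real_normed_field, euclidean_space}, 'a) normed_module \<Rightarrow> real \<Rightarrow> ('a \<Rightarrow> 'k) set" where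
  "dual_ball X C =
     {f \<in> extensional (carrier X).
        (\<forall>x\<in>carrier X. \<forall>y\<in>carrier X. f (x \<oplus>\<^bsub>X\<^esub> y) = f x + f y) \<and>
        (\<forall>c. \<forall>x\<in>carrier X. f (c \<odot>\<^bsub>X\<^esub> x) = c * f x) \<and>
        (\<forall>x\<in>carrier X. norm (f x) \<le> C * nrm X x)}"

lemma functional_iff_dual_ball:
  "f \<in> bounded_linear_maps X scalar_space \<longleftrightarrow> (\<exists>C. f \<in> dual_ball X C)"
  by (auto simp: bounded_linear_maps_def dual_ball_def PiE_def)

lemma dual_ballD:
  assumes "f \<in> dual_ball X C"
  shows "f \<in> extensional (carrier X)"
    "x \<in> carrier X \<Longrightarrow> y \<in> carrier X \<Longrightarrow> f (x \<oplus>\<^bsub>X\<^esub> y) = f x + f y"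
    "x \<in> carrier X \<Longrightarrow> f (c \<odot>\<^bsub>X\<^esub> x) = c * f x"
    "x \<in> carrier X \<Longrightarrow> norm (f x) \<le> C * nrm X x"
  using assms by (auto simp: dual_ball_def)

lemma dual_ballI:
  assumes "f \<in> extensional (carrier X)"
    "\<And>x y. x \<in> carrier X \<Longrightarrow> y \<in> carrier X \<Longrightarrow> f (x \<oplus>\<^bsub>X\<^esub> y) = f x + f y"
    "\<And>c x. x \<in> carrier X \<Longrightarrow> f (c \<odot>\<^bsub>X\<^esub> x) = c * f x"
    "\<And>x. x \<in> carrier X \<Longrightarrow> norm (f x) \<le> C * nrm X x"
  shows "f \<in> dual_ball X C"
  using assms by (auto simp: dual_ball_def)

context normed_space
begin

lemma dual_ball_zero: "f \<in> dual_ball X C \<Longrightarrow> f \<zero> = 0"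
  using dual_ballD(3)[of f X C \<zero> 0] by simp

lemma dual_ball_diff:
  "f \<in> dual_ball X C \<Longrightarrow> x \<in> carrier X \<Longrightarrow> y \<in> carrier X \<Longrightarrow> f (x \<ominus> y) = f x - f y"
  by (simp add: minus_eq dual_ballD)

lemma dual_ball_mono: "C \<le> C' \<Longrightarrow> dual_ball X C \<subseteq> dual_ball X C'"
  unfolding dual_ball_def using mult_right_mono[OF _ nrm_nonneg, of C C'] by (fastforce intro: order_trans)

lemma functional_dual_ball:
  assumes "f \<in> bounded_linear_maps X scalar_space"
  obtains C where "0 \<le> C" "f \<in> dual_ball X C"
  by (metis assms dual_ball_mono functional_iff_dual_ball abs_ge_self abs_ge_zero subsetD)

lemma dual_nrm_le:
  assumes f: "f \<in> dual_ball X C" and C: "0 \<le> C"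
  shows "nrm (dual_space X) f \<le> C"
proof -
  have "norm (f x) \<le> C" if "x \<in> carrier X" "nrm X x \<le> 1" for x
    using dual_ballD(4)[OF f that(1)] mult_left_mono[OF that(2) C] by simp
  \<comment> \<open>A bound on all values passes to the supremum only over a nonempty index
    set.\<close>
  moreover have "\<zero> \<in> {x \<in> carrier X. nrm X x \<le> 1}" by simp
  ultimately show ?thesis
    by (auto simp: dual_space_def intro!: cSUP_least)
qed

lemma smult_unit_ball:
  assumes x: "x \<in> carrier X" and nz: "nrm X x \<noteq> 0"
  shows "nrm X (of_real (inverse (nrm X x)) \<odot> x) = 1"
  using x nz by (simp add: nrm_smult nrm_nonneg norm_inverse)

lemma norm_le_dual_nrm:
  assumes f: "f \<in> bounded_linear_maps X scalar_space" and x: "x \<in> carrier X" "nrm X x \<le> 1"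
  shows "norm (f x) \<le> nrm (dual_space X) f"
proof -
  obtain C where C: "0 \<le> C" "f \<in> dual_ball X C" using functional_dual_ball[OF f] .
  have bdd: "bdd_above ((\<lambda>x. norm (f x)) ` {x \<in> carrier X. nrm X x \<le> 1})"
  proof (rule bdd_aboveI2)
    show "norm (f x) \<le> C" if "x \<in> {x \<in> carrier X. nrm X x \<le> 1}" for x
      using dual_ballD(4)[OF C(2), of x] mult_left_mono[OF _ C(1), of "nrm X x" 1] that by auto
  qed
  show ?thesis
    unfolding dual_space_def using x by (auto intro!: cSUP_upper[OF _ bdd])
qed

text \<open>Normalising a nonzero vector reduces the claim to the unit ball, over which the dual
  norm is the supremum.\<close>

lemma mem_dual_ball_nrm:
  assumes f: "f \<in> bounded_linear_maps X scalar_space"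
  shows "f \<in> dual_ball X (nrm (dual_space X) f)"
proof -
  obtain C where C: "0 \<le> C" "f \<in> dual_ball X C" using functional_dual_ball[OF f] .
  have "norm (f x) \<le> nrm (dual_space X) f * nrm X x" if x: "x \<in> carrier X" for x
  proof (cases "nrm X x = 0")
    case True
    then show ?thesis using x nrm_eq_0[OF x] dual_ball_zero[OF C(2)] by simp
  next
    case False
    let ?u = "of_real (inverse (nrm X x)) \<odot> x"
    have "norm (f ?u) \<le> nrm (dual_space X) f"
      using smult_unit_ball[OF x False] x by (intro norm_le_dual_nrm[OF f]) auto
    moreover have "norm (f ?u) = norm (f x) / nrm X x"
      using x by (simp add: dual_ballD(3)[OF C(2)] norm_mult norm_inverse nrm_nonneg divide_inverse)
    ultimately show ?thesis
      using False nrm_nonneg[OF x] by (simp add: divide_le_eq split: if_splits)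
  qed
  then show ?thesis using C(2) by (auto simp: dual_ball_def)
qed

end

lemma carrier_dual_space: "carrier (dual_space X) = bounded_linear_maps X scalar_space"
  by (simp add: dual_space_def)

text \<open>The pullback is the adjoint of \<open>T\<close>, whose norm is at most
  \<open>B\<close>.\<close>

lemma dual_ball_comp:
  assumes X: "normed_space X" and T: "T \<in> bounded_linear_maps X Y"
    and B: "\<And>x. x \<in> carrier X \<Longrightarrow> nrm Y (T x) \<le> B * nrm X x"
    and f: "f \<in> dual_ball Y C" and C: "0 \<le> C"
  shows "(\<lambda>x\<in>carrier X. f (T x)) \<in> dual_ball X (C * B)"
proof -
  interpret X: normed_space X by fact
  note TD = bounded_linear_mapsD[OF T]
  show ?thesis
  proof (rule dual_ballI)
    fix x assume x: "x \<in> carrier X"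
    have "norm (f (T x)) \<le> C * nrm Y (T x)" using dual_ballD(4)[OF f] TD(1)[OF x] .
    also have "\<dots> \<le> C * (B * nrm X x)" using B[OF x] C by (rule mult_left_mono)
    finally show "norm ((\<lambda>x\<in>carrier X. f (T x)) x) \<le> C * B * nrm X x" using x by (simp add: mult.assoc)
  qed (use TD dual_ballD[OF f] in auto)
qed

section \<open>Completeness through sequences and norms of differences\<close>

lemma banach_space_iff:
  "banach_space X \<longleftrightarrow> normed_space X \<and>
    (\<forall>\<sigma> :: nat \<Rightarrow> 'a. range \<sigma> \<subseteq> carrier X \<longrightarrow>
       (\<forall>e>0. \<exists>N. \<forall>m\<ge>N. \<forall>n\<ge>N. nrm X (\<sigma> m \<ominus>\<^bsub>X\<^esub> \<sigma> n) < e) \<longrightarrow>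
       (\<exists>x\<in>carrier X. (\<lambda>n. nrm X (\<sigma> n \<ominus>\<^bsub>X\<^esub> x)) \<longlonglongrightarrow> 0))"
  for X :: "('k::{real_normed_field, euclidean_space}, 'a) normed_module"
proof (cases "normed_space X")
  case True
  interpret X: normed_space X by fact
  interpret Metric_space "carrier X" "nrm_dist X" by (rule X.Metric_space)
  have d: "nrm_dist X x y = nrm X (x \<ominus>\<^bsub>X\<^esub> y)" if "x \<in> carrier X" "y \<in> carrier X" for x y
    using that by (simp add: nrm_dist_def)
  have lim: "limitin mtopology \<sigma> x sequentially \<longleftrightarrow>
      x \<in> carrier X \<and> (\<lambda>n. nrm X (\<sigma> n \<ominus>\<^bsub>X\<^esub> x)) \<longlonglongrightarrow> 0" if "range \<sigma> \<subseteq> carrier X" for \<sigma> x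
  proof -
    have "\<sigma> n \<in> carrier X" for n using that by auto
    then show ?thesis
      by (auto simp: limit_metric_sequentially LIMSEQ_iff d X.nrm_nonneg)
  qed
  have C: "MCauchy \<sigma> \<longleftrightarrow> range \<sigma> \<subseteq> carrier X \<and>
      (\<forall>e>0. \<exists>N. \<forall>m\<ge>N. \<forall>n\<ge>N. nrm X (\<sigma> m \<ominus>\<^bsub>X\<^esub> \<sigma> n) < e)" for \<sigma>
  proof (cases "range \<sigma> \<subseteq> carrier X")
    case True
    then have "\<sigma> n \<in> carrier X" for n by auto
    then show ?thesis by (simp add: MCauchy_def d)
  qed (simp add: MCauchy_def)
  have "(MCauchy \<sigma> \<longrightarrow> (\<exists>x. limitin mtopology \<sigma> x sequentially)) \<longleftrightarrow>
      (range \<sigma> \<subseteq> carrier X \<longrightarrow>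
       (\<forall>e>0. \<exists>N. \<forall>m\<ge>N. \<forall>n\<ge>N. nrm X (\<sigma> m \<ominus>\<^bsub>X\<^esub> \<sigma> n) < e) \<longrightarrow>
       (\<exists>x\<in>carrier X. (\<lambda>n. nrm X (\<sigma> n \<ominus>\<^bsub>X\<^esub> x)) \<longlonglongrightarrow> 0))" for \<sigma>
    unfolding C by (cases "range \<sigma> \<subseteq> carrier X") (simp_all add: lim Bex_def)
  then show ?thesis
    unfolding banach_space_def mcomplete_def by simp
qed (simp add: banach_space_def)

lemma banach_space_limit:
  fixes \<sigma> :: "nat \<Rightarrow> 'a"
  assumes X: "banach_space X" and \<sigma>: "\<And>n. \<sigma> n \<in> carrier X"
    and cauchy: "\<And>e. 0 < e \<Longrightarrow> \<exists>N. \<forall>m\<ge>N. \<forall>n\<ge>N. nrm X (\<sigma> m \<ominus>\<^bsub>X\<^esub> \<sigma> n) < e"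
  obtains x where "x \<in> carrier X" "(\<lambda>n. nrm X (\<sigma> n \<ominus>\<^bsub>X\<^esub> x)) \<longlonglongrightarrow> 0"
proof -
  have "range \<sigma> \<subseteq> carrier X" using \<sigma> by auto
  from X[unfolded banach_space_iff, THEN conjunct2, THEN spec[of _ \<sigma>], THEN mp, OF this]
  show thesis using cauchy that by auto
qed

section \<open>Separable spaces and images of BFU spaces\<close>

text \<open>The Hausdorff condition is automatic for functions with values in a metric space. What
  remains concerns closures and limits, both of which are tested at single points of
  \<open>S\<close>.\<close>

lemma frechet_urysohn_pointwise_iff:
  fixes B :: "('a \<Rightarrow> 'k::metric_space) set"
  assumes B: "B \<subseteq> extensional S"
  shows "frechet_urysohn_space (subtopology (product_topology (\<lambda>_. euclidean) S) B) \<longleftrightarrow>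
    (\<forall>G\<subseteq>B. \<forall>t\<in>B. adherent S G t \<longrightarrow> seq_adherent S G t)"
proof -
  let ?P = "product_topology (\<lambda>_. euclidean) S :: ('a \<Rightarrow> 'k) topology"
  let ?T = "subtopology ?P B"
  have top: "topspace ?T = B" using B by (auto simp: PiE_def)
  have haus: "Hausdorff_space ?T"
    by (intro Hausdorff_space_subtopology) (simp add: Hausdorff_space_product_topology)
  have clos: "t \<in> Abstract_Topology.closure_of ?T G \<longleftrightarrow> t \<in> B \<and> adherent S G t" if "G \<subseteq> B" for G t
    using that B closure_of_product_euclidean[of G S t]
    by (auto simp: closure_of_subtopology Int_absorb1)
  have lim: "limitin ?T s t sequentially \<longleftrightarrow> (\<forall>x\<in>S. (\<lambda>n. s n x) \<longlonglongrightarrow> t x)"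
    if "t \<in> B" "range s \<subseteq> B" for s t
  proof -
    have "s n \<in> B" "s n \<in> topspace ?P" for n using that B by (auto simp: PiE_def)
    then show ?thesis
      using that B by (auto simp: limitin_subtopology limitin_componentwise)
  qed
  show ?thesis
    unfolding frechet_urysohn_space_def top seq_adherent_def using haus clos lim
    by (smt (verit, best) order_trans)
qed

lemma dual_ball_subset_extensional: "dual_ball X C \<subseteq> extensional (carrier X)"
  by (auto simp: dual_ball_def)

text \<open>Every norm bounded set lies in a ball, and the sequential condition for a ball restricts
  to its subsets, because both \<open>G\<close> and the limit may be taken there.\<close>

lemma BFU_space_iff:
  "BFU_space X \<longleftrightarrow> banach_space X \<and>
    (\<forall>C\<ge>0. \<forall>G\<subseteq>dual_ball X C. \<forall>t\<in>dual_ball X C.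
       adherent (carrier X) G t \<longrightarrow> seq_adherent (carrier X) G t)"
proof (cases "banach_space X")
  case True
  then interpret normed_space X by (simp add: banach_space_def)
  let ?P = "product_topology (\<lambda>_. euclidean) (carrier X)"
  have ext: "carrier (dual_space X) \<subseteq> extensional (carrier X)"
    by (auto simp: dual_space_def bounded_linear_maps_def PiE_def)
  have FU: "frechet_urysohn_space (subtopology (weak_star_topology X) B) \<longleftrightarrow>
      (\<forall>G\<subseteq>B. \<forall>t\<in>B. adherent (carrier X) G t \<longrightarrow> seq_adherent (carrier X) G t)"
    if "B \<subseteq> carrier (dual_space X)" for B
  proof -
    have "subtopology (weak_star_topology X) B = subtopology ?P B"
      using that by (simp add: weak_star_topology_def subtopology_subtopology Int_absorb1)
    then show ?thesis using frechet_urysohn_pointwise_iff[of B] that ext by auto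
  qed
  show ?thesis
    unfolding BFU_space_def
  proof (intro arg_cong2[where f = "(\<and>)"] refl iffI allI impI ballI)
    fix C G t assume H: "\<forall>B. nrm_bounded (dual_space X) B \<longrightarrow>
        frechet_urysohn_space (subtopology (weak_star_topology X) B)"
      and C: "0 \<le> C" and G: "G \<subseteq> dual_ball X C" "t \<in> dual_ball X C" "adherent (carrier X) G t"
    have sub: "dual_ball X C \<subseteq> carrier (dual_space X)"
      by (auto simp: carrier_dual_space functional_iff_dual_ball)
    then have "nrm_bounded (dual_space X) (dual_ball X C)"
      using dual_nrm_le C by (auto simp: nrm_bounded_def)
    then show "seq_adherent (carrier X) G t" using H FU[OF sub] G by blast
  next
    fix B assume H: "\<forall>C\<ge>0. \<forall>G\<subseteq>dual_ball X C. \<forall>t\<in>dual_ball X C.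
        adherent (carrier X) G t \<longrightarrow> seq_adherent (carrier X) G t"
      and B: "nrm_bounded (dual_space X) B"
    obtain C where C: "B \<subseteq> carrier (dual_space X)" "\<And>f. f \<in> B \<Longrightarrow> nrm (dual_space X) f \<le> C"
      using B unfolding nrm_bounded_def by blast
    \<comment> \<open>The bound \<open>C\<close> can be negative when \<open>B\<close> is empty,
      while the balls in question have nonnegative radius.\<close>
    have "B \<subseteq> dual_ball X (max 0 C)"
    proof
      fix f assume f: "f \<in> B"
      then have "f \<in> dual_ball X (nrm (dual_space X) f)"
        using C(1) by (intro mem_dual_ball_nrm) (auto simp: carrier_dual_space)
      then show "f \<in> dual_ball X (max 0 C)"
        using dual_ball_mono[OF max.coboundedI2[OF C(2)[OF f]]] by blast
    qed
    then show "frechet_urysohn_space (subtopology (weak_star_topology X) B)"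
      unfolding FU[OF C(1)] using H by (meson max.cobounded1 subset_trans subsetD)
  qed
qed (simp add: BFU_space_def)

lemma BFU_spaceI:
  assumes "banach_space X"
    and "\<And>C G t. 0 \<le> C \<Longrightarrow> G \<subseteq> dual_ball X C \<Longrightarrow> t \<in> dual_ball X C \<Longrightarrow>
      adherent (carrier X) G t \<Longrightarrow> seq_adherent (carrier X) G t"
  shows "BFU_space X"
  using assms by (simp add: BFU_space_iff)

lemma BFU_spaceD:
  assumes "BFU_space X"
  shows "banach_space X" "normed_space X"
    "0 \<le> C \<Longrightarrow> G \<subseteq> dual_ball X C \<Longrightarrow> t \<in> dual_ball X C \<Longrightarrow>
      adherent (carrier X) G t \<Longrightarrow> seq_adherent (carrier X) G t"
  using assms by (auto simp: BFU_space_iff banach_space_def)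

section \<open>Separable spaces and bounded linear surjections\<close>

lemma separable_banach_space_iff:
  "separable_banach_space X \<longleftrightarrow> banach_space X \<and>
    (\<exists>D. countable D \<and> D \<subseteq> carrier X \<and>
       (\<forall>x\<in>carrier X. \<forall>e>0. \<exists>d\<in>D. nrm X (x \<ominus>\<^bsub>X\<^esub> d) < e))"
proof (cases "banach_space X")
  case True
  then interpret normed_space X by (simp add: banach_space_def)
  interpret Metric_space "carrier X" "nrm_dist X" by (rule Metric_space)
  have "Abstract_Topology.closure_of mtopology D =
      {x \<in> carrier X. \<forall>e>0. \<exists>d\<in>D. nrm X (x \<ominus>\<^bsub>X\<^esub> d) < e}" if "D \<subseteq> carrier X" for D
  proof -
    have "y \<in> mball x r \<longleftrightarrow> nrm X (x \<ominus>\<^bsub>X\<^esub> y) < r" if "x \<in> carrier X" "y \<in> D" for x y r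
      using that \<open>D \<subseteq> carrier X\<close> by (auto simp: nrm_dist_def)
    then show ?thesis unfolding metric_closure_of by (intro Collect_cong) blast
  qed
  then have "Abstract_Topology.closure_of mtopology D = carrier X \<longleftrightarrow>
      (\<forall>x\<in>carrier X. \<forall>e>0. \<exists>d\<in>D. nrm X (x \<ominus>\<^bsub>X\<^esub> d) < e)" if "D \<subseteq> carrier X" for D
    using that by blast
  then show ?thesis
    using True by (auto simp: separable_banach_space_def separable_space_def nrm_topology_def)
qed (simp add: separable_banach_space_def)

text \<open>All functionals of the ball are Lipschitz with the same constant \<open>C\<close>. This
  equicontinuity carries pointwise convergence from a dense set to the whole space.\<close>

lemma (in normed_space) dual_ball_tendsto_dense:
  fixes s :: "nat \<Rightarrow> 'a \<Rightarrow> 'k"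
  assumes s: "\<And>n. s n \<in> dual_ball X C" and t: "t \<in> dual_ball X C" and C: "0 \<le> C"
    and D: "D \<subseteq> carrier X" "\<And>x e. x \<in> carrier X \<Longrightarrow> 0 < e \<Longrightarrow> \<exists>d\<in>D. nrm X (x \<ominus> d) < e"
    and lim: "\<And>d. d \<in> D \<Longrightarrow> (\<lambda>n. s n d) \<longlonglongrightarrow> t d" and x: "x \<in> carrier X"
  shows "(\<lambda>n. s n x) \<longlonglongrightarrow> t x"
proof (rule tendstoI)
  fix e :: real assume e: "0 < e"
  \<comment> \<open>Adding 1 to \<open>C\<close> admits the radius 0. Moving from \<open>x\<close>
    to \<open>d\<close> then costs less than \<open>e / 4\<close> for every functional of the ball,
    and three such errors stay below \<open>e\<close>.\<close>
  then have "0 < e / (4 * (C + 1))" using C by simp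
  from D(2)[OF x this] obtain d where d: "d \<in> D" "nrm X (x \<ominus> d) < e / (4 * (C + 1))" by blast
  have dX: "d \<in> carrier X" using d D(1) by auto
  have "(C + 1) * nrm X (x \<ominus> d) < e / 4" using d(2) C by (simp add: field_simps)
  then have small: "C * nrm X (x \<ominus> d) < e / 4"
    using nrm_nonneg[of "x \<ominus> d"] x dX by (simp add: distrib_right)
  have near: "dist (f x) (f d) < e / 4" if "f \<in> dual_ball X C" for f :: "'a \<Rightarrow> 'k"
    using dual_ballD(4)[OF that, of "x \<ominus> d"] dual_ball_diff[OF that x dX] small x dX
    by (simp add: dist_norm)
  from lim[OF d(1)] e have "\<forall>\<^sub>F n in sequentially. dist (s n d) (t d) < e / 4"
    by (intro tendstoD) auto
  then show "\<forall>\<^sub>F n in sequentially. dist (s n x) (t x) < e"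
  proof eventually_elim
    case (elim n)
    have "dist (s n x) (t x) \<le> dist (s n x) (s n d) + dist (s n d) (t d) + dist (t x) (t d)"
      using dist_triangle[of "s n x" "t x" "s n d"] dist_triangle[of "s n d" "t x" "t d"]
      by (simp add: dist_commute)
    then show ?case using elim near[OF s[of n]] near[OF t] e by linarith
  qed
qed

lemma BFU_space_separable:
  assumes "separable_banach_space X"
  shows "BFU_space X"
proof (rule BFU_spaceI)
  show B: "banach_space X" using assms by (simp add: separable_banach_space_def)
  then interpret normed_space X by (simp add: banach_space_def)
  obtain D where D: "countable D" "D \<subseteq> carrier X"
    "\<And>x e. x \<in> carrier X \<Longrightarrow> 0 < e \<Longrightarrow> \<exists>d\<in>D. nrm X (x \<ominus>\<^bsub>X\<^esub> d) < e"
    using assms unfolding separable_banach_space_iff by blast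
  fix C G t assume C: "0 \<le> C" and G: "G \<subseteq> dual_ball X C" "t \<in> dual_ball X C"
    "adherent (carrier X) G t"
  obtain s where s: "range s \<subseteq> G" "\<And>d. d \<in> D \<Longrightarrow> (\<lambda>n. s n d) \<longlonglongrightarrow> t d"
    using adherent_countable_seq[OF G(3) D(1,2)] unfolding seq_adherent_def by blast
  have "(\<lambda>n. s n x) \<longlonglongrightarrow> t x" if "x \<in> carrier X" for x
    by (rule dual_ball_tendsto_dense[OF _ G(2) C D(2,3) s(2) that]) (use s(1) G(1) in auto)
  then show "seq_adherent (carrier X) G t" using s(1) unfolding seq_adherent_def by blast
qed

text \<open>A finite set \<open>F\<close> in \<open>X\<close> tests pullbacks as its image under
  \<open>T\<close> tests the functionals, so adherence passes from \<open>Z\<close> to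
  \<open>X\<close>. Convergence passes back because every vector of \<open>Z\<close> has a preimage
  at which the pullbacks can be evaluated.\<close>

lemma BFU_space_image:
  assumes X: "BFU_space X" and Z: "banach_space Z"
    and T: "T \<in> bounded_linear_maps X Z" "T ` carrier X = carrier Z"
  shows "BFU_space Z"
proof (rule BFU_spaceI[OF Z])
  fix C G t assume C: "0 \<le> C" and G: "G \<subseteq> dual_ball Z C" "t \<in> dual_ball Z C"
    "adherent (carrier Z) G t"
  interpret X: normed_space X using BFU_spaceD[OF X] by simp
  obtain B where B: "0 < B" "\<And>x. x \<in> carrier X \<Longrightarrow> nrm Z (T x) \<le> B * nrm X x"
    using bounded_linear_maps_bound[OF X.normed_space_axioms T(1)] by blast
  let ?p = "\<lambda>f. \<lambda>x\<in>carrier X. f (T x)"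
  have p: "?p f \<in> dual_ball X (C * B)" if "f \<in> dual_ball Z C" for f
    by (rule dual_ball_comp[OF X.normed_space_axioms T(1) B(2) that C])
  have "adherent (carrier X) (?p ` G) (?p t)"
    unfolding adherent_def
  proof (intro allI impI)
    fix F and e :: real assume F: "finite F" "F \<subseteq> carrier X" "0 < e"
    then have "T ` F \<subseteq> carrier Z" using T(2) by auto
    then obtain g where g: "g \<in> G" "\<forall>x\<in>T ` F. dist (g x) (t x) < e"
      using adherentD[OF G(3), of "T ` F" e] F by auto
    then show "\<exists>g\<in>?p ` G. \<forall>x\<in>F. dist (g x) (?p t x) < e"
      using F(2) by (intro bexI[of _ "?p g"]) auto
  qed
  then have "seq_adherent (carrier X) (?p ` G) (?p t)"
    using p G C B by (intro BFU_spaceD(3)[OF X, of "C * B"]) auto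
  then obtain s where s: "range s \<subseteq> ?p ` G" "\<And>x. x \<in> carrier X \<Longrightarrow> (\<lambda>n. s n x) \<longlonglongrightarrow> ?p t x"
    unfolding seq_adherent_def by blast
  \<comment> \<open>The sequence found in \<open>X\<close> consists of pullbacks of members of
    \<open>G\<close>, so functionals on \<open>Z\<close> can be recovered from it by choice.\<close>
  then have "\<forall>n. \<exists>g. g \<in> G \<and> s n = ?p g" by blast
  from choice[OF this] obtain g where g: "\<And>n. g n \<in> G" "\<And>n. s n = ?p (g n)" by blast
  have "(\<lambda>n. g n z) \<longlonglongrightarrow> t z" if "z \<in> carrier Z" for z
  proof -
    have "z \<in> T ` carrier X" using that T(2) by simp
    then obtain x where x: "x \<in> carrier X" "z = T x" by (rule imageE)
    have "s n x = g n z" for n using x by (simp add: g(2))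
    then show ?thesis using s(2)[OF x(1)] x by simp
  qed
  then show "seq_adherent (carrier Z) G t" using g(1) unfolding seq_adherent_def by blast
qed

text \<open>Preimages of controlled norm turn a rapidly converging subsequence in \<open>Z\<close>
  into a sequence in \<open>X\<close> with summable increments. Its limit in \<open>X\<close> is
  mapped to the limit sought in \<open>Z\<close>.\<close>

lemma banach_space_lift:
  assumes X: "banach_space X" and Z: "normed_space Z" and T: "T \<in> bounded_linear_maps X Z"
    and lift: "\<And>z. z \<in> carrier Z \<Longrightarrow> \<exists>x\<in>carrier X. T x = z \<and> nrm X x \<le> C * nrm Z z"
  shows "banach_space Z"
  unfolding banach_space_iff
proof (intro conjI allI impI Z)
  interpret X: normed_space X using X by (simp add: banach_space_def)
  interpret Z: normed_space Z by (rule Z)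
  note TD = bounded_linear_mapsD[OF T]
  obtain B where B: "0 < B" "\<And>x. x \<in> carrier X \<Longrightarrow> nrm Z (T x) \<le> B * nrm X x"
    using bounded_linear_maps_bound[OF X.normed_space_axioms T] by blast
  \<comment> \<open>The given \<open>C\<close> can be negative if \<open>Z\<close> is the zero
    space.\<close>
  define K where "K = max 0 C"
  have K: "0 \<le> K" by (simp add: K_def)
  have lift': "\<exists>x\<in>carrier X. T x = z \<and> nrm X x \<le> K * nrm Z z" if z: "z \<in> carrier Z" for z
    using lift[OF z] mult_right_mono[OF _ Z.nrm_nonneg[OF z], of C K] unfolding K_def by fastforce
  then obtain l where l: "\<And>z. z \<in> carrier Z \<Longrightarrow> l z \<in> carrier X \<and> T (l z) = z \<and> nrm X (l z) \<le> K * nrm Z z"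
    by metis
  fix \<sigma> :: "nat \<Rightarrow> _" assume "range \<sigma> \<subseteq> carrier Z"
    and cau: "\<forall>e>0. \<exists>N. \<forall>m\<ge>N. \<forall>n\<ge>N. nrm Z (\<sigma> m \<ominus>\<^bsub>Z\<^esub> \<sigma> n) < e"
  then have \<sigma>: "\<sigma> n \<in> carrier Z" for n by auto
  \<comment> \<open>Beyond \<open>r k\<close> any two terms differ by less than
    \<open>(1/2) ^ k\<close>. Strict growth places \<open>r (Suc k)\<close> in that tail.\<close>
  have "\<exists>r. \<forall>k. (\<forall>m\<ge>r k. \<forall>n\<ge>r k. nrm Z (\<sigma> m \<ominus>\<^bsub>Z\<^esub> \<sigma> n) < (1/2) ^ k) \<and> r k < r (Suc k)"
  proof (rule dependent_nat_choice)
    show "\<exists>N. \<forall>m\<ge>N. \<forall>n\<ge>N. nrm Z (\<sigma> m \<ominus>\<^bsub>Z\<^esub> \<sigma> n) < (1/2) ^ 0" using cau by simp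
    fix N k
    obtain M where M: "\<forall>m\<ge>M. \<forall>n\<ge>M. nrm Z (\<sigma> m \<ominus>\<^bsub>Z\<^esub> \<sigma> n) < (1/2) ^ Suc k"
      using cau[rule_format, of "(1/2) ^ Suc k"] by auto
    show "\<exists>M. (\<forall>m\<ge>M. \<forall>n\<ge>M. nrm Z (\<sigma> m \<ominus>\<^bsub>Z\<^esub> \<sigma> n) < (1/2) ^ Suc k) \<and> N < M"
      by (rule exI[of _ "max M (Suc N)"]) (use M in auto)
  qed
  then obtain r where r: "\<And>k m n. r k \<le> m \<Longrightarrow> r k \<le> n \<Longrightarrow> nrm Z (\<sigma> m \<ominus>\<^bsub>Z\<^esub> \<sigma> n) < (1/2) ^ k"
    "\<And>k. r k < r (Suc k)" by blast
  \<comment> \<open>The lift of the first chosen term, to which the lifts of the successive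
    increments are added, so that \<open>T (x k) = \<sigma> (r k)\<close>. Lifting the terms
    separately would give no control over differences.\<close>
  define x where "x = rec_nat (l (\<sigma> (r 0))) (\<lambda>k y. y \<oplus>\<^bsub>X\<^esub> l (\<sigma> (r (Suc k)) \<ominus>\<^bsub>Z\<^esub> \<sigma> (r k)))"
  have x_Suc: "x (Suc k) = x k \<oplus>\<^bsub>X\<^esub> l (\<sigma> (r (Suc k)) \<ominus>\<^bsub>Z\<^esub> \<sigma> (r k))" for k by (simp add: x_def)
  have x: "x k \<in> carrier X \<and> T (x k) = \<sigma> (r k)" for k
  proof (induction k)
    case 0
    then show ?case using l[OF \<sigma>] by (simp add: x_def)
  next
    case (Suc k)
    then show ?case using l[of "\<sigma> (r (Suc k)) \<ominus>\<^bsub>Z\<^esub> \<sigma> (r k)"] \<sigma> TD(3)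
      by (simp add: x_Suc Z.add_diff)
  qed
  have step: "nrm X (x (Suc k) \<ominus>\<^bsub>X\<^esub> x k) \<le> K * (1/2) ^ k" for k
  proof -
    let ?z = "\<sigma> (r (Suc k)) \<ominus>\<^bsub>Z\<^esub> \<sigma> (r k)"
    have "nrm X (x (Suc k) \<ominus>\<^bsub>X\<^esub> x k) = nrm X (l ?z)"
      using x[of k] l[of ?z] \<sigma> by (simp add: x_Suc X.add_diff_cancel)
    also have "\<dots> \<le> K * nrm Z ?z" using l[of ?z] \<sigma> by simp
    also have "\<dots> \<le> K * (1/2) ^ k"
      using r(1)[of k "r (Suc k)" "r k"] r(2)[of k] K by (intro mult_left_mono) auto
    finally show ?thesis .
  qed
  \<comment> \<open>The bracket is the exact value of the geometric sum of \<open>(1/2) ^ i\<close>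
    for \<open>i\<close> from \<open>k\<close> to \<open>k + j - 1\<close>, so that the induction
    closes without loss.\<close>
  have far: "nrm X (x (k + j) \<ominus>\<^bsub>X\<^esub> x k) \<le> K * (2 * (1/2) ^ k - 2 * (1/2) ^ (k + j))" for k j
  proof (induction j)
    case 0
    have "x k \<ominus>\<^bsub>X\<^esub> x k = \<zero>\<^bsub>X\<^esub>" using x by (simp add: a_minus_def X.M.r_neg)
    then show ?case by simp
  next
    case (Suc j)
    have "nrm X (x (k + Suc j) \<ominus>\<^bsub>X\<^esub> x k) \<le>
        nrm X (x (Suc (k + j)) \<ominus>\<^bsub>X\<^esub> x (k + j)) + nrm X (x (k + j) \<ominus>\<^bsub>X\<^esub> x k)"
      using X.nrm_diff_triangle[of "x (Suc (k + j))" "x (k + j)" "x k"] x by simp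
    also have "\<dots> \<le> K * (1/2) ^ (k + j) + K * (2 * (1/2) ^ k - 2 * (1/2) ^ (k + j))"
      using step[of "k + j"] Suc by linarith
    also have "\<dots> = K * (2 * (1/2) ^ k - 2 * (1/2) ^ (k + Suc j))"
      by (simp add: algebra_simps)
    finally show ?case .
  qed
  have far': "nrm X (x m \<ominus>\<^bsub>X\<^esub> x k) \<le> 2 * K * (1/2) ^ k" if "k \<le> m" for k m
  proof -
    have "nrm X (x m \<ominus>\<^bsub>X\<^esub> x k) \<le> K * (2 * (1/2) ^ k - 2 * (1/2) ^ m)"
      using far[of k "m - k"] that by simp
    also have "\<dots> \<le> K * (2 * (1/2) ^ k)" using K by (intro mult_left_mono) auto
    finally show ?thesis by (simp add: mult_ac)
  qed
  have half: "(\<lambda>k. c * (1/2) ^ k) \<longlonglongrightarrow> 0" for c :: real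
    using tendsto_mult_right_zero[OF LIMSEQ_realpow_zero[of "1/2"], of c] by simp
  have x_cauchy: "\<exists>N. \<forall>m\<ge>N. \<forall>n\<ge>N. nrm X (x m \<ominus>\<^bsub>X\<^esub> x n) < e" if e: "0 < e" for e
  proof -
    obtain k where k: "4 * K * (1/2) ^ k < e"
      using order_tendstoD(2)[OF half[of "4 * K"] e] eventually_happens'[OF sequentially_bot] by blast
    have "nrm X (x m \<ominus>\<^bsub>X\<^esub> x n) < e" if "k \<le> m" "k \<le> n" for m n
      using X.nrm_diff_triangle[of "x m" "x k" "x n"] far'[OF that(1)] far'[OF that(2)] k
        X.nrm_diff_commute[of "x k" "x n"] x by auto
    then show ?thesis by blast
  qed
  obtain y where y: "y \<in> carrier X" "(\<lambda>n. nrm X (x n \<ominus>\<^bsub>X\<^esub> y)) \<longlonglongrightarrow> 0"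
    by (rule banach_space_limit[OF X _ x_cauchy]) (use x in auto)
  show "\<exists>z\<in>carrier Z. (\<lambda>n. nrm Z (\<sigma> n \<ominus>\<^bsub>Z\<^esub> z)) \<longlonglongrightarrow> 0"
  proof (intro bexI[of _ "T y"] TD(1) y(1) LIMSEQ_I)
    fix e :: real assume e: "0 < e"
    \<comment> \<open>A single \<open>k\<close> bounds the whole tail of \<open>\<sigma>\<close>:
      one summand bounds the distance from \<open>\<sigma> (r k)\<close> to \<open>T y\<close>, the
      other the distance from later terms to \<open>\<sigma> (r k)\<close>.\<close>
    have "(\<lambda>k. B * nrm X (x k \<ominus>\<^bsub>X\<^esub> y) + 1 * (1/2) ^ k) \<longlonglongrightarrow> B * 0 + 0"
      by (intro tendsto_intros y(2) half)
    then have "\<forall>\<^sub>F k in sequentially. B * nrm X (x k \<ominus>\<^bsub>X\<^esub> y) + (1/2) ^ k < e"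
      using e by (intro order_tendstoD(2)) auto
    then obtain k where k: "B * nrm X (x k \<ominus>\<^bsub>X\<^esub> y) + (1/2) ^ k < e"
      using eventually_happens'[OF sequentially_bot] by blast
    have "nrm Z (\<sigma> n \<ominus>\<^bsub>Z\<^esub> T y) < e" if n: "r k \<le> n" for n
    proof -
      have "nrm Z (\<sigma> n \<ominus>\<^bsub>Z\<^esub> T y) \<le> nrm Z (\<sigma> n \<ominus>\<^bsub>Z\<^esub> \<sigma> (r k)) + nrm Z (\<sigma> (r k) \<ominus>\<^bsub>Z\<^esub> T y)"
        using Z.nrm_diff_triangle \<sigma> TD(1)[OF y(1)] by simp
      moreover have "\<sigma> (r k) \<ominus>\<^bsub>Z\<^esub> T y = T (x k \<ominus>\<^bsub>X\<^esub> y)"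
        using bounded_linear_maps_diff[OF X.normed_space_axioms Z T, of "x k" y] x y(1) by simp
      moreover have "nrm Z (T (x k \<ominus>\<^bsub>X\<^esub> y)) \<le> B * nrm X (x k \<ominus>\<^bsub>X\<^esub> y)" using B(2) x y(1) by simp
      ultimately show ?thesis using r(1)[of k n "r k"] n k by simp
    qed
    then show "\<exists>N. \<forall>n\<ge>N. norm (nrm Z (\<sigma> n \<ominus>\<^bsub>Z\<^esub> T y) - 0) < e"
      using \<sigma> TD(1)[OF y(1)] by (auto simp: Z.nrm_nonneg)
  qed
qed

section \<open>Complemented subspaces and quotients\<close>

text \<open>Every element of \<open>Z\<close> has the form \<open>q x\<close>, so the algebraic laws
  of \<open>X\<close> are carried over by \<open>q\<close>. Only the norm needs separate
  assumptions, because \<open>q\<close> need not be isometric.\<close>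

lemma normed_space_image:
  fixes Z :: "('k::{real_normed_field, euclidean_space}, 'b) normed_module"
  assumes X: "normed_space X" and q: "q ` carrier X = carrier Z"
    and add: "\<And>x y. x \<in> carrier X \<Longrightarrow> y \<in> carrier X \<Longrightarrow> q (x \<oplus>\<^bsub>X\<^esub> y) = q x \<oplus>\<^bsub>Z\<^esub> q y"
    and smult: "\<And>c x. x \<in> carrier X \<Longrightarrow> q (c \<odot>\<^bsub>X\<^esub> x) = c \<odot>\<^bsub>Z\<^esub> q x"
    and zero: "q \<zero>\<^bsub>X\<^esub> = \<zero>\<^bsub>Z\<^esub>"
    and nrm_0: "\<And>x. x \<in> carrier X \<Longrightarrow> nrm Z (q x) = 0 \<Longrightarrow> q x = \<zero>\<^bsub>Z\<^esub>"
    and nrm_smult: "\<And>c x. x \<in> carrier X \<Longrightarrow> nrm Z (q (c \<odot>\<^bsub>X\<^esub> x)) = norm c * nrm Z (q x)"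
    and nrm_add: "\<And>x y. x \<in> carrier X \<Longrightarrow> y \<in> carrier X \<Longrightarrow>
      nrm Z (q (x \<oplus>\<^bsub>X\<^esub> y)) \<le> nrm Z (q x) + nrm Z (q y)"
  shows "normed_space Z"
proof -
  interpret X: normed_space X by (rule X)
  have nrm_zero: "nrm Z \<zero>\<^bsub>Z\<^esub> = 0"
    using nrm_smult[of "\<zero>\<^bsub>X\<^esub>" 0] by (simp add: zero)
  then have nrm_iff: "nrm Z (q x) = 0 \<longleftrightarrow> q x = q \<zero>\<^bsub>X\<^esub>" if "x \<in> carrier X" for x
    using nrm_0[OF that] by (auto simp: zero)
  show ?thesis
    \<comment> \<open>Elements of \<open>Z\<close> are replaced by images, and the compatibility
      equations are then read backwards to gather both sides of each law under one
      \<open>q\<close>.\<close>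
    by (rule normed_spaceI; unfold q[symmetric]; ((elim imageE; hypsubst)?))
      (simp_all add: add[symmetric] smult[symmetric] zero[symmetric] X.M.a_assoc X.smult_assoc
        X.l_distr X.r_distr nrm_smult nrm_add nrm_iff, simp_all add: X.M.a_comm)
qed

lemma BFU_space_complemented:
  assumes X: "BFU_space X" and M: "complemented_subspace M X"
  shows "BFU_space (subspace_space X M)"
proof -
  let ?Z = "subspace_space X M"
  interpret X: normed_space X using BFU_spaceD(2)[OF X] .
  obtain P where P: "P \<in> bounded_linear_maps X X" "P ` carrier X = M" "\<And>x. x \<in> M \<Longrightarrow> P x = x"
    using M by (auto simp: complemented_subspace_def)
  note PD = bounded_linear_mapsD[OF P(1)]
  have simps: "carrier ?Z = M" "add ?Z = add X" "smult ?Z = smult X" "zero ?Z = zero X" "nrm ?Z = nrm X"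
    by (simp_all add: subspace_space_def)
  have PX: "M \<subseteq> carrier X" using PD(1) P(2) by auto
  have P0: "P \<zero>\<^bsub>X\<^esub> = \<zero>\<^bsub>X\<^esub>" using PD(4)[of "\<zero>\<^bsub>X\<^esub>" 0] PD(1)[of "\<zero>\<^bsub>X\<^esub>"] by simp
  have Z: "normed_space ?Z"
    by (rule normed_space_image[OF X.normed_space_axioms, of P])
      (simp_all add: simps P(2) PD P0 X.nrm_eq_0 X.nrm_smult X.nrm_triangle)
  have T: "P \<in> bounded_linear_maps X ?Z"
    using P(1,2) by (auto simp: bounded_linear_maps_def simps PiE_def)
  show ?thesis
  proof (rule BFU_space_image[OF X _ T])
    show "banach_space ?Z"
      \<comment> \<open>A vector of \<open>M\<close> is its own preimage under the projection, hence
        the constant 1.\<close>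
      by (rule banach_space_lift[OF BFU_spaceD(1)[OF X] Z T, of 1])
        (use P(3) PX in \<open>auto simp: simps\<close>)
    show "P ` carrier X = carrier ?Z" by (simp add: simps P(2))
  qed
qed

lemma BFU_space_quotient:
  assumes X: "BFU_space X" and M: "closed_subspace M X"
  shows "BFU_space (quotient_space X M)"
proof -
  let ?Z = "quotient_space X M"
  interpret X: normed_space X using BFU_spaceD(2)[OF X] .
  have sub: "submodule M scalar_ring X" and closed: "closedin (nrm_topology X) M"
    using M by (auto simp: closed_subspace_def)
  note M_closed = X.submoduleE[OF sub]
  have MX: "m \<in> carrier X" if "m \<in> M" for m using M_closed(1) that by auto
  interpret S: abelian_subgroup M X
    using sub X.M.abelian_group_axioms
    by (intro abelian_subgroupI3 additive_subgroupI) (auto simp: submodule_def)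
  have zM: "\<zero>\<^bsub>X\<^esub> \<in> M" by simp
  define q where "q = (\<lambda>x. M +>\<^bsub>X\<^esub> x)"
  have q_eq: "q (m \<oplus>\<^bsub>X\<^esub> x) = q x" if "m \<in> M" "x \<in> carrier X" for m x
    unfolding q_def using that MX
    by (metis X.M.a_rcosI M_closed(1) S.a_subgroup X.M.a_repr_independence)
  have simps: "carrier ?Z = q ` carrier X" "zero ?Z = M" "nrm ?Z S = (INF x\<in>S. nrm X x)" for S
    by (auto simp: quotient_space_def q_def A_RCOSETS_def')
  have q_add: "q x \<oplus>\<^bsub>?Z\<^esub> q y = q (x \<oplus>\<^bsub>X\<^esub> y)" if "x \<in> carrier X" "y \<in> carrier X" for x y
    using that by (simp add: quotient_space_def q_def S.a_rcos_sum)
  have q_mem: "q x = (\<lambda>m. m \<oplus>\<^bsub>X\<^esub> x) ` M" for x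
    by (auto simp: q_def a_r_coset_def')
  have q_smult: "c \<odot>\<^bsub>?Z\<^esub> q x = q (c \<odot>\<^bsub>X\<^esub> x)" if x: "x \<in> carrier X" for c x
  proof -
    have "q (c \<odot>\<^bsub>X\<^esub> (m \<oplus>\<^bsub>X\<^esub> x)) = q (c \<odot>\<^bsub>X\<^esub> x)" if "m \<in> M" for m
      using that x MX M_closed(4)[of c m] by (simp add: X.r_distr q_eq)
    \<comment> \<open>All cosets in this union coincide, because representatives of
      \<open>q x\<close> differ by elements of \<open>M\<close> and \<open>M\<close> is stable under
      scalars.\<close>
    then have "(\<Union>y\<in>q x. q (c \<odot>\<^bsub>X\<^esub> y)) = q (c \<odot>\<^bsub>X\<^esub> x)"
      using M_closed(2) by (auto simp: q_mem[of x])
    then show ?thesis by (simp add: quotient_space_def q_def)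
  qed
  have q_zero: "q \<zero>\<^bsub>X\<^esub> = M" by (simp add: q_def M_closed(1))
  have bdd: "bdd_below ((\<lambda>m. nrm X (m \<oplus>\<^bsub>X\<^esub> x)) ` M)" if "x \<in> carrier X" for x
    using that MX by (intro bdd_belowI2[of _ 0]) (auto intro: X.nrm_nonneg)
  have nq: "nrm ?Z (q x) = (INF m\<in>M. nrm X (m \<oplus>\<^bsub>X\<^esub> x))" for x
    by (simp add: simps q_mem image_image)
  have nrm_le: "nrm ?Z (q x) \<le> nrm X (m \<oplus>\<^bsub>X\<^esub> x)" if "x \<in> carrier X" "m \<in> M" for x m
    unfolding nq using bdd that by (intro cINF_lower) auto
  have nrm_less: "\<exists>m\<in>M. nrm X (m \<oplus>\<^bsub>X\<^esub> x) < c" if "x \<in> carrier X" "nrm ?Z (q x) < c" for x c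
    using that(2) bdd[OF that(1)] zM M_closed(2) unfolding nq by (subst (asm) cINF_less_iff) auto
  have nrm_ge: "0 \<le> nrm ?Z (q x)" if "x \<in> carrier X" for x
    unfolding nq using that MX M_closed(2) by (intro cINF_greatest) (auto intro: X.nrm_nonneg)
  have smult_le: "nrm ?Z (q (c \<odot>\<^bsub>X\<^esub> x)) \<le> norm c * nrm ?Z (q x)" if x: "x \<in> carrier X" for c x
  proof (rule field_le_epsilon)
    fix e :: real assume e: "0 < e"
    \<comment> \<open>The summand 1 avoids a division by zero for \<open>c = 0\<close>. After
      multiplication by \<open>norm c\<close> the error is still at most \<open>e\<close>.\<close>
    then have "0 < e / (norm c + 1)" by (simp add: add_nonneg_pos)
    then obtain m where m: "m \<in> M" "nrm X (m \<oplus>\<^bsub>X\<^esub> x) < nrm ?Z (q x) + e / (norm c + 1)"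
      using nrm_less[OF x, of "nrm ?Z (q x) + e / (norm c + 1)"] by auto
    have "nrm ?Z (q (c \<odot>\<^bsub>X\<^esub> x)) \<le> nrm X (c \<odot>\<^bsub>X\<^esub> m \<oplus>\<^bsub>X\<^esub> c \<odot>\<^bsub>X\<^esub> x)"
      using x M_closed(4)[of c m] m(1) by (intro nrm_le) auto
    also have "\<dots> = norm c * nrm X (m \<oplus>\<^bsub>X\<^esub> x)"
      using x m(1) MX by (simp add: X.r_distr[symmetric] X.nrm_smult)
    also have "\<dots> \<le> norm c * (nrm ?Z (q x) + e / (norm c + 1))"
      using m(2) by (intro mult_left_mono) auto
    also have "\<dots> \<le> norm c * nrm ?Z (q x) + e"
    proof -
      have "norm c * (e / (norm c + 1)) \<le> e"
        using e add_nonneg_pos[OF norm_ge_zero[of c] zero_less_one]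
          pos_divide_le_eq[of "norm c + 1" "norm c * e" e] by (simp add: algebra_simps)
      then show ?thesis by (simp add: distrib_left)
    qed
    finally show "nrm ?Z (q (c \<odot>\<^bsub>X\<^esub> x)) \<le> norm c * nrm ?Z (q x) + e" .
  qed
  have nrm_0: "q x = M" if x: "x \<in> carrier X" and n: "nrm ?Z (q x) = 0" for x
  proof -
    interpret Metric_space "carrier X" "nrm_dist X" by (rule X.Metric_space)
    \<comment> \<open>Here closedness of \<open>M\<close> enters. Quotient norm 0 gives vectors
      \<open>m\<close> of \<open>M\<close> with \<open>m \<oplus> x\<close> arbitrarily small. Their
      negatives lie in \<open>M\<close> and approach \<open>x\<close>.\<close>
    have "x \<in> M"
    proof (rule ccontr)
      assume "x \<notin> M"
      then obtain r where r: "0 < r" "disjnt M (mball x r)"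
        using closed x by (auto simp: nrm_topology_def closedin_metric)
      obtain m where m: "m \<in> M" "nrm X (m \<oplus>\<^bsub>X\<^esub> x) < r" using nrm_less[OF x, of r] n r(1) by auto
      have "x \<ominus>\<^bsub>X\<^esub> (\<ominus>\<^bsub>X\<^esub> m) = m \<oplus>\<^bsub>X\<^esub> x" using x MX[OF m(1)] by (simp add: a_minus_def X.M.a_comm)
      then have "\<ominus>\<^bsub>X\<^esub> m \<in> mball x r" using x MX[OF m(1)] m(2) by (simp add: nrm_dist_def)
      then show False using r(2) M_closed(3)[OF m(1)] by (auto simp: disjnt_iff)
    qed
    then show ?thesis using q_eq[of x "\<zero>\<^bsub>X\<^esub>"] x by (simp add: q_zero)
  qed
  have Z: "normed_space ?Z"
  proof (rule normed_space_image[OF X.normed_space_axioms, of q])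
    fix x y assume x: "x \<in> carrier X" and y: "y \<in> carrier X"
    show "nrm ?Z (q (x \<oplus>\<^bsub>X\<^esub> y)) \<le> nrm ?Z (q x) + nrm ?Z (q y)"
    proof (rule field_le_epsilon)
      fix e :: real assume e: "0 < e"
      obtain m where m: "m \<in> M" "nrm X (m \<oplus>\<^bsub>X\<^esub> x) < nrm ?Z (q x) + e / 2"
        using nrm_less[OF x, of "nrm ?Z (q x) + e / 2"] e by auto
      obtain n where n: "n \<in> M" "nrm X (n \<oplus>\<^bsub>X\<^esub> y) < nrm ?Z (q y) + e / 2"
        using nrm_less[OF y, of "nrm ?Z (q y) + e / 2"] e by auto
      have "nrm ?Z (q (x \<oplus>\<^bsub>X\<^esub> y)) \<le> nrm X ((m \<oplus>\<^bsub>X\<^esub> n) \<oplus>\<^bsub>X\<^esub> (x \<oplus>\<^bsub>X\<^esub> y))"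
        using x y m(1) n(1) by (intro nrm_le) auto
      also have "(m \<oplus>\<^bsub>X\<^esub> n) \<oplus>\<^bsub>X\<^esub> (x \<oplus>\<^bsub>X\<^esub> y) = (m \<oplus>\<^bsub>X\<^esub> x) \<oplus>\<^bsub>X\<^esub> (n \<oplus>\<^bsub>X\<^esub> y)"
        using x y MX m(1) n(1) by (simp add: X.M.a_ac)
      also have "nrm X \<dots> \<le> nrm X (m \<oplus>\<^bsub>X\<^esub> x) + nrm X (n \<oplus>\<^bsub>X\<^esub> y)"
        using x y MX m(1) n(1) by (intro X.nrm_triangle) auto
      finally show "nrm ?Z (q (x \<oplus>\<^bsub>X\<^esub> y)) \<le> nrm ?Z (q x) + nrm ?Z (q y) + e"
        using m(2) n(2) by simp
    qed
  next
    fix c :: 'b and x assume x: "x \<in> carrier X"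
    show "nrm ?Z (q (c \<odot>\<^bsub>X\<^esub> x)) = norm c * nrm ?Z (q x)"
    proof (cases "c = 0")
      case True
      then show ?thesis using smult_le[OF x, of 0] nrm_ge[of "0 \<odot>\<^bsub>X\<^esub> x"] x by simp
    next
      case False
      \<comment> \<open>The reverse inequality is the one already proved, applied to
        \<open>inverse c\<close> and the vector multiplied by \<open>c\<close>.\<close>
      have "nrm ?Z (q x) = nrm ?Z (q (inverse c \<odot>\<^bsub>X\<^esub> (c \<odot>\<^bsub>X\<^esub> x)))"
        using x False by (simp add: X.smult_assoc[symmetric])
      also have "\<dots> \<le> norm (inverse c) * nrm ?Z (q (c \<odot>\<^bsub>X\<^esub> x))" using x by (intro smult_le) auto
      finally have "norm c * nrm ?Z (q x) \<le>
          norm c * norm (inverse c) * nrm ?Z (q (c \<odot>\<^bsub>X\<^esub> x))"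
        by (simp add: mult.assoc mult_left_mono)
      moreover have "norm c * norm (inverse c) = 1" using False by (simp add: norm_inverse)
      ultimately have "norm c * nrm ?Z (q x) \<le> nrm ?Z (q (c \<odot>\<^bsub>X\<^esub> x))" by simp
      then show ?thesis using smult_le[OF x, of c] by simp
    qed
  next
    show "q x = \<zero>\<^bsub>?Z\<^esub>" if "x \<in> carrier X" "nrm ?Z (q x) = 0" for x
      using nrm_0[OF that] by (simp only: simps(2))
  qed (simp_all add: simps(1,2) q_add q_smult q_zero)
  let ?T = "\<lambda>x\<in>carrier X. q x"
  have T: "?T \<in> bounded_linear_maps X ?Z"
    unfolding bounded_linear_maps_def
  proof (intro CollectI conjI exI[of _ 1] ballI)
    show "nrm ?Z (?T x) \<le> 1 * nrm X x" if "x \<in> carrier X" for x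
      using nrm_le[OF that zM] that by simp
  qed (auto simp: simps(1) q_add q_smult)
  show ?thesis
  proof (rule BFU_space_image[OF X _ T])
    show "banach_space ?Z"
    proof (rule banach_space_lift[OF BFU_spaceD(1)[OF X] Z T, of 2])
      fix z assume "z \<in> carrier ?Z"
      then obtain x where x: "x \<in> carrier X" "z = q x" by (auto simp: simps)
      show "\<exists>x\<in>carrier X. ?T x = z \<and> nrm X x \<le> 2 * nrm ?Z z"
      \<comment> \<open>The infimum defining the quotient norm need not be attained, so some factor
        above 1 is required for the lift. At norm 0 the strict inequality fails, and the zero vector
        is the lift.\<close>
      proof (cases "nrm ?Z z = 0")
        case True
        then show ?thesis
          using nrm_0[of x] x by (intro bexI[of _ "\<zero>\<^bsub>X\<^esub>"]) (auto simp: q_zero)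
      next
        case False
        then have "nrm ?Z (q x) < 2 * nrm ?Z (q x)" using nrm_ge[OF x(1)] x(2) by simp
        from nrm_less[OF x(1) this] obtain m where
          m: "m \<in> M" "nrm X (m \<oplus>\<^bsub>X\<^esub> x) < 2 * nrm ?Z (q x)" by blast
        then show ?thesis
          using x MX q_eq[OF m(1) x(1)] by (intro bexI[of _ "m \<oplus>\<^bsub>X\<^esub> x"]) auto
      qed
    qed
    show "?T ` carrier X = carrier ?Z" by (simp add: simps(1))
  qed
qed

section \<open>Products with a separable space\<close>

lemma prod_space_simps [simp]:
  "carrier (prod_space X Y) = carrier X \<times> carrier Y"
  "zero (prod_space X Y) = (zero X, zero Y)"
  "add (prod_space X Y) (x, y) (x', y') = (add X x x', add Y y y')"
  "smult (prod_space X Y) c (x, y) = (smult X c x, smult Y c y)"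
  "nrm (prod_space X Y) (x, y) = max (nrm X x) (nrm Y y)"
  by (simp_all add: prod_space_def)

lemma normed_space_prod:
  assumes "normed_space X" "normed_space Y"
  shows "normed_space (prod_space X Y)"
proof -
  interpret X: normed_space X by fact
  interpret Y: normed_space Y by fact
  show ?thesis
  proof (rule normed_spaceI)
    fix p q assume p: "p \<in> carrier (prod_space X Y)" and q: "q \<in> carrier (prod_space X Y)"
    then show "nrm (prod_space X Y) (p \<oplus>\<^bsub>prod_space X Y\<^esub> q) \<le>
        nrm (prod_space X Y) p + nrm (prod_space X Y) q"
      using X.nrm_triangle[of "fst p" "fst q"] Y.nrm_triangle[of "snd p" "snd q"] by auto
  next
    fix p assume p: "p \<in> carrier (prod_space X Y)"
    then show "nrm (prod_space X Y) p = 0 \<longleftrightarrow> p = \<zero>\<^bsub>prod_space X Y\<^esub>"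
      using X.nrm_nonneg[of "fst p"] Y.nrm_nonneg[of "snd p"]
        X.nrm_eq_0[of "fst p"] Y.nrm_eq_0[of "snd p"] by (auto simp: max_def split: if_splits)
  qed (auto simp: X.M.a_ac Y.M.a_ac X.l_distr Y.l_distr X.r_distr
      Y.r_distr X.smult_assoc Y.smult_assoc X.nrm_smult Y.nrm_smult max_mult_distrib_left)
qed

lemma prod_space_minus:
  assumes "normed_space X" "normed_space Y"
    and "x \<in> carrier X" "x' \<in> carrier X" "y \<in> carrier Y" "y' \<in> carrier Y"
  shows "(x, y) \<ominus>\<^bsub>prod_space X Y\<^esub> (x', y') = (x \<ominus>\<^bsub>X\<^esub> x', y \<ominus>\<^bsub>Y\<^esub> y')"
proof -
  interpret X: normed_space X by fact
  interpret Y: normed_space Y by fact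
  interpret P: normed_space "prod_space X Y" by (rule normed_space_prod) unfold_locales
  show ?thesis using assms(3-) by (simp add: P.minus_eq X.minus_eq Y.minus_eq)
qed

lemma banach_space_prod:
  assumes X: "banach_space X" and Y: "banach_space Y"
  shows "banach_space (prod_space X Y)"
  unfolding banach_space_iff
proof (intro conjI allI impI)
  interpret X: normed_space X using X by (simp add: banach_space_def)
  interpret Y: normed_space Y using Y by (simp add: banach_space_def)
  interpret P: normed_space "prod_space X Y" by (rule normed_space_prod) unfold_locales
  show "normed_space (prod_space X Y)" by unfold_locales
  fix \<sigma> :: "nat \<Rightarrow> _" assume ran: "range \<sigma> \<subseteq> carrier (prod_space X Y)"
    and cau: "\<forall>e>0. \<exists>N. \<forall>m\<ge>N. \<forall>n\<ge>N. nrm (prod_space X Y) (\<sigma> m \<ominus>\<^bsub>prod_space X Y\<^esub> \<sigma> n) < e"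
  define a b where "a n = fst (\<sigma> n)" and "b n = snd (\<sigma> n)" for n
  have ab: "\<sigma> n = (a n, b n)" "a n \<in> carrier X" "b n \<in> carrier Y" for n
    using subsetD[OF ran rangeI[of \<sigma> n]] by (auto simp: a_def b_def mem_Times_iff)
  have nrm_diff: "nrm (prod_space X Y) (\<sigma> n \<ominus>\<^bsub>prod_space X Y\<^esub> (x, y)) =
      max (nrm X (a n \<ominus>\<^bsub>X\<^esub> x)) (nrm Y (b n \<ominus>\<^bsub>Y\<^esub> y))" if "x \<in> carrier X" "y \<in> carrier Y" for n x y
    using ab that by (simp add: prod_space_minus[OF X.normed_space_axioms Y.normed_space_axioms])
  have cau': "\<forall>e>0. \<exists>N. \<forall>m\<ge>N. \<forall>n\<ge>N. max (nrm X (a m \<ominus>\<^bsub>X\<^esub> a n)) (nrm Y (b m \<ominus>\<^bsub>Y\<^esub> b n)) < e"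
    using cau nrm_diff[OF ab(2,3)] by (simp add: ab(1))
  have a_cauchy: "\<exists>N. \<forall>m\<ge>N. \<forall>n\<ge>N. nrm X (a m \<ominus>\<^bsub>X\<^esub> a n) < e" if "0 < e" for e
    using cau' that by fastforce
  obtain x where x: "x \<in> carrier X" "(\<lambda>n. nrm X (a n \<ominus>\<^bsub>X\<^esub> x)) \<longlonglongrightarrow> 0"
    by (rule banach_space_limit[OF X ab(2) a_cauchy])
  have b_cauchy: "\<exists>N. \<forall>m\<ge>N. \<forall>n\<ge>N. nrm Y (b m \<ominus>\<^bsub>Y\<^esub> b n) < e" if "0 < e" for e
    using cau' that by fastforce
  obtain y where y: "y \<in> carrier Y" "(\<lambda>n. nrm Y (b n \<ominus>\<^bsub>Y\<^esub> y)) \<longlonglongrightarrow> 0"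
    by (rule banach_space_limit[OF Y ab(3) b_cauchy])
  show "\<exists>p\<in>carrier (prod_space X Y).
      (\<lambda>n. nrm (prod_space X Y) (\<sigma> n \<ominus>\<^bsub>prod_space X Y\<^esub> p)) \<longlonglongrightarrow> 0"
    using tendsto_max[OF x(2) y(2)] x(1) y(1)
    by (intro bexI[of _ "(x, y)"]) (simp_all add: nrm_diff)
qed

text \<open>A pointwise adherent sequence for the second component alone need not converge in the first
  component. The functionals are therefore shifted by \<open>\<phi> / (n + 1)\<close> with \<open>\<phi> \<noteq> 0\<close>, where \<open>n\<close>
  measures how well the first component is approximated on a dense sequence: a sequence of shifted
  functionals can only converge to the limit if \<open>n\<close> tends to infinity.\<close>

lemma BFU_space_prod:
  fixes X :: "('k::{real_normed_field, euclidean_space}, 'a) normed_module"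
    and Y :: "('k, 'b) normed_module"
  assumes X: "separable_banach_space X" and Y: "BFU_space Y"
  shows "BFU_space (prod_space X Y)"
proof (rule BFU_spaceI)
  show "banach_space (prod_space X Y)"
    using X BFU_spaceD(1)[OF Y] by (intro banach_space_prod) (simp add: separable_banach_space_def)
  let ?Z = "prod_space X Y"
  have bX: "banach_space X" using X by (simp add: separable_banach_space_def)
  then interpret X: normed_space X by (simp add: banach_space_def)
  interpret Y: normed_space Y using BFU_spaceD(2)[OF Y] .
  interpret Z: normed_space ?Z by (rule normed_space_prod) unfold_locales
  obtain D where D: "countable D" "D \<subseteq> carrier X"
    "\<And>x e. x \<in> carrier X \<Longrightarrow> 0 < e \<Longrightarrow> \<exists>d\<in>D. nrm X (x \<ominus>\<^bsub>X\<^esub> d) < e"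
    using X unfolding separable_banach_space_iff by blast
  fix C G t assume C: "0 \<le> C" and G: "G \<subseteq> dual_ball ?Z C" "t \<in> dual_ball ?Z C"
    and ad: "adherent (carrier ?Z) G t"
  let ?X = "\<lambda>f. \<lambda>x\<in>carrier X. f (x, \<zero>\<^bsub>Y\<^esub>)" and ?Y = "\<lambda>f. \<lambda>y\<in>carrier Y. f (\<zero>\<^bsub>X\<^esub>, y)"
  have fX: "?X f \<in> dual_ball X C" if f: "f \<in> dual_ball ?Z C" for f
  proof (rule dual_ballI)
    show "?X f (x \<oplus>\<^bsub>X\<^esub> x') = ?X f x + ?X f x'" if "x \<in> carrier X" "x' \<in> carrier X" for x x'
      using dual_ballD(2)[OF f, of "(x, \<zero>\<^bsub>Y\<^esub>)" "(x', \<zero>\<^bsub>Y\<^esub>)"] that by simp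
    show "?X f (c \<odot>\<^bsub>X\<^esub> x) = c * ?X f x" if "x \<in> carrier X" for c x
      using dual_ballD(3)[OF f, of "(x, \<zero>\<^bsub>Y\<^esub>)" c] that by simp
    show "norm (?X f x) \<le> C * nrm X x" if "x \<in> carrier X" for x
      using dual_ballD(4)[OF f, of "(x, \<zero>\<^bsub>Y\<^esub>)"] that by (simp add: max.absorb1 X.nrm_nonneg)
  qed simp
  have fY: "?Y f \<in> dual_ball Y C" if f: "f \<in> dual_ball ?Z C" for f
  proof (rule dual_ballI)
    show "?Y f (y \<oplus>\<^bsub>Y\<^esub> y') = ?Y f y + ?Y f y'" if "y \<in> carrier Y" "y' \<in> carrier Y" for y y'
      using dual_ballD(2)[OF f, of "(\<zero>\<^bsub>X\<^esub>, y)" "(\<zero>\<^bsub>X\<^esub>, y')"] that by simp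
    show "?Y f (c \<odot>\<^bsub>Y\<^esub> y) = c * ?Y f y" if "y \<in> carrier Y" for c y
      using dual_ballD(3)[OF f, of "(\<zero>\<^bsub>X\<^esub>, y)" c] that by simp
    show "norm (?Y f y) \<le> C * nrm Y y" if "y \<in> carrier Y" for y
      using dual_ballD(4)[OF f, of "(\<zero>\<^bsub>X\<^esub>, y)"] that by (simp add: max.absorb2 Y.nrm_nonneg)
  qed simp
  have split: "f (x, y) = f (x, \<zero>\<^bsub>Y\<^esub>) + f (\<zero>\<^bsub>X\<^esub>, y)"
    if f: "f \<in> dual_ball ?Z C" and "x \<in> carrier X" "y \<in> carrier Y" for f x y
    using dual_ballD(2)[OF f, of "(x, \<zero>\<^bsub>Y\<^esub>)" "(\<zero>\<^bsub>X\<^esub>, y)"] that by simp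
  \<comment> \<open>Every functional splits into its parts on the two factors. On the first,
    \<open>D\<close> suffices by equicontinuity. On the second, convergence must be known
    everywhere.\<close>
  have glue: "seq_adherent (carrier ?Z) G t"
    if g: "\<And>n. g n \<in> G" and gD: "\<And>d. d \<in> D \<Longrightarrow> (\<lambda>n. g n (d, \<zero>\<^bsub>Y\<^esub>)) \<longlonglongrightarrow> t (d, \<zero>\<^bsub>Y\<^esub>)"
      and gY: "\<And>y. y \<in> carrier Y \<Longrightarrow> (\<lambda>n. g n (\<zero>\<^bsub>X\<^esub>, y)) \<longlonglongrightarrow> t (\<zero>\<^bsub>X\<^esub>, y)" for g :: "nat \<Rightarrow> _"
  proof -
    have gZ: "g n \<in> dual_ball ?Z C" for n using g G(1) by auto
    have "(\<lambda>n. g n (x, y)) \<longlonglongrightarrow> t (x, y)" if xy: "x \<in> carrier X" "y \<in> carrier Y" for x y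
    proof -
      have "(\<lambda>n. ?X (g n) x) \<longlonglongrightarrow> ?X t x"
      proof (rule X.dual_ball_tendsto_dense[OF fX[OF gZ] fX[OF G(2)] C D(2,3) _ xy(1)])
        fix d assume d: "d \<in> D"
        then have "d \<in> carrier X" using D(2) by auto
        then show "(\<lambda>n. ?X (g n) d) \<longlonglongrightarrow> ?X t d" using gD[OF d] by simp
      qed
      then have "(\<lambda>n. g n (x, \<zero>\<^bsub>Y\<^esub>) + g n (\<zero>\<^bsub>X\<^esub>, y)) \<longlonglongrightarrow> t (x, \<zero>\<^bsub>Y\<^esub>) + t (\<zero>\<^bsub>X\<^esub>, y)"
        using xy gY[OF xy(2)] by (intro tendsto_add) simp_all
      then show ?thesis by (simp add: split[OF gZ xy] split[OF G(2) xy])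
    qed
    moreover have "range g \<subseteq> G" using g by auto
    ultimately show ?thesis unfolding seq_adherent_def by (intro exI[of _ g]) auto
  qed
  show "seq_adherent (carrier ?Z) G t"
  \<comment> \<open>If all functionals on \<open>Y\<close> vanish, there is nothing to shift by, but
    then the second parts are zero and countably many conditions on \<open>D\<close> decide.\<close>
  proof (cases "\<exists>\<phi> B y. \<phi> \<in> dual_ball Y B \<and> y \<in> carrier Y \<and> \<phi> y \<noteq> 0")
    case False
    then have zero: "f (\<zero>\<^bsub>X\<^esub>, y) = 0" if "f \<in> dual_ball ?Z C" "y \<in> carrier Y" for f y
      using fY[OF that(1)] that(2) by force
    have "seq_adherent ((\<lambda>d. (d, \<zero>\<^bsub>Y\<^esub>)) ` D) G t"
      by (rule adherent_countable_seq[OF ad]) (use D(1,2) in auto)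
    then obtain g where g: "range g \<subseteq> G" "\<And>d. d \<in> D \<Longrightarrow> (\<lambda>n. g n (d, \<zero>\<^bsub>Y\<^esub>)) \<longlonglongrightarrow> t (d, \<zero>\<^bsub>Y\<^esub>)"
      by (auto simp: seq_adherent_def)
    have gG: "g n \<in> G" for n using g(1) by auto
    have gZ: "g n \<in> dual_ball ?Z C" for n using gG G(1) by auto
    show ?thesis
    proof (rule glue[OF gG])
      show "(\<lambda>n. g n (d, \<zero>\<^bsub>Y\<^esub>)) \<longlonglongrightarrow> t (d, \<zero>\<^bsub>Y\<^esub>)" if "d \<in> D" for d
        using g(2)[OF that] .
      show "(\<lambda>n. g n (\<zero>\<^bsub>X\<^esub>, y)) \<longlonglongrightarrow> t (\<zero>\<^bsub>X\<^esub>, y)" if "y \<in> carrier Y" for y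
        using zero[OF gZ that] zero[OF G(2) that] by simp
    qed
  next
    case True
    then obtain \<phi> B0 y1 where \<phi>0: "\<phi> \<in> dual_ball Y B0" "y1 \<in> carrier Y" "\<phi> y1 \<noteq> 0" by blast
    define B where "B = max 0 B0"
    have B: "0 \<le> B" "\<phi> \<in> dual_ball Y B"
      using \<phi>0(1) Y.dual_ball_mono[of B0 B] by (auto simp: B_def)
    \<comment> \<open>Normalised so that the shift changes the value at \<open>y0\<close> by exactly
      \<open>1 / (n + 1)\<close>.\<close>
    define y0 where "y0 = inverse (\<phi> y1) \<odot>\<^bsub>Y\<^esub> y1"
    have y0: "y0 \<in> carrier Y" "\<phi> y0 = 1"
      using \<phi>0(2,3) dual_ballD(3)[OF \<phi>0(1)] by (simp_all add: y0_def)
    obtain k :: "'a \<Rightarrow> nat" where k: "inj_on k D" using D(1) by (rule countableE)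
    let ?D = "\<lambda>n. {d \<in> D. k d \<le> n}"
    have finD: "finite (?D n)" for n
      by (rule finite_imageD[of k]) (auto intro: finite_subset[of _ "{..n}"] inj_on_subset[OF k])
    let ?e = "\<lambda>n. inverse (real (Suc n))"
    \<comment> \<open>The tolerance at \<open>y0\<close> is half of the later shift. A shifted
      member of \<open>Gn n\<close> therefore stays more than \<open>1 / (2 * (n + 1))\<close> away
      from the limit at \<open>y0\<close>, and this gap reveals \<open>n\<close>.\<close>
    define Gn where "Gn n = {g \<in> G. (\<forall>d\<in>?D n. dist (g (d, \<zero>\<^bsub>Y\<^esub>)) (t (d, \<zero>\<^bsub>Y\<^esub>)) < ?e n) \<and>
        dist (g (\<zero>\<^bsub>X\<^esub>, y0)) (t (\<zero>\<^bsub>X\<^esub>, y0)) < ?e n / 2}" for n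
    define shift where "shift n g = (\<lambda>y\<in>carrier Y. g (\<zero>\<^bsub>X\<^esub>, y) + of_real (?e n) * \<phi> y)" for n g
    \<comment> \<open>Since \<open>?e n \<le> 1\<close>, all shifts stay in one common ball, so the
      hypothesis on \<open>Y\<close> applies to the union over all \<open>n\<close>.\<close>
    have shift_ball: "shift n g \<in> dual_ball Y (C + B)" if g: "g \<in> G" for n g
    proof -
      have gY: "?Y g \<in> dual_ball Y C" using fY g G(1) by auto
      show ?thesis
      proof (rule dual_ballI)
        fix y assume y: "y \<in> carrier Y"
        have "norm (of_real (?e n) :: 'k) \<le> 1" unfolding norm_of_real by (simp add: field_simps)
        then have "norm (of_real (?e n) * \<phi> y) \<le> 1 * (B * nrm Y y)"
          unfolding norm_mult by (intro mult_mono dual_ballD(4)[OF B(2) y]) auto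
        moreover have "norm (g (\<zero>\<^bsub>X\<^esub>, y)) \<le> C * nrm Y y" using dual_ballD(4)[OF gY y] y by simp
        ultimately have "norm (g (\<zero>\<^bsub>X\<^esub>, y) + of_real (?e n) * \<phi> y) \<le> C * nrm Y y + B * nrm Y y"
          by (intro norm_triangle_le) linarith
        then show "norm (shift n g y) \<le> (C + B) * nrm Y y"
          using y by (simp add: shift_def distrib_right)
      next
        show "shift n g (y \<oplus>\<^bsub>Y\<^esub> y') = shift n g y + shift n g y'"
          if "y \<in> carrier Y" "y' \<in> carrier Y" for y y'
          using dual_ballD(2)[OF gY that] dual_ballD(2)[OF B(2) that] that
          by (simp add: shift_def distrib_left)
        show "shift n g (c \<odot>\<^bsub>Y\<^esub> y) = c * shift n g y" if "y \<in> carrier Y" for c y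
          using dual_ballD(3)[OF gY that] dual_ballD(3)[OF B(2) that] that
          by (simp add: shift_def distrib_left mult.left_commute)
      qed (simp add: shift_def)
    qed
    define A where "A = (\<Union>n. shift n ` Gn n)"
    have "A \<subseteq> dual_ball Y (C + B)" using shift_ball by (auto simp: A_def Gn_def)
    moreover have "?Y t \<in> dual_ball Y (C + B)"
      using fY[OF G(2)] Y.dual_ball_mono[of C "C + B"] B(1) by auto
    \<comment> \<open>First \<open>n\<close> is taken so large that the shift is small on
      \<open>F\<close>. Adherence of \<open>G\<close> then provides a member of \<open>Gn n\<close>
      that is close to \<open>t\<close> on \<open>F\<close>.\<close>
    moreover have "adherent (carrier Y) A (?Y t)"
      unfolding adherent_def
    proof (intro allI impI)
      fix F and e :: real assume F: "finite F" "F \<subseteq> carrier Y" "0 < e"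
      have "(\<lambda>n. ?e n * norm (\<phi> y)) \<longlonglongrightarrow> 0" for y
        by (rule tendsto_mult_left_zero[OF LIMSEQ_inverse_real_of_nat])
      then have "\<forall>\<^sub>F n in sequentially. ?e n * norm (\<phi> y) < e / 2" for y
        using F(3) by (intro order_tendstoD(2)) auto
      then have "\<forall>\<^sub>F n in sequentially. \<forall>y\<in>F. ?e n * norm (\<phi> y) < e / 2"
        by (intro eventually_ball_finite F(1)) auto
      then obtain n where n: "\<forall>y\<in>F. ?e n * norm (\<phi> y) < e / 2"
        using eventually_happens'[OF sequentially_bot] by blast
      let ?P = "(\<lambda>d. (d, \<zero>\<^bsub>Y\<^esub>)) ` ?D n \<union> Pair \<zero>\<^bsub>X\<^esub> ` insert y0 F"
      have "finite ?P" using finD F(1) by simp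
      moreover have "?P \<subseteq> carrier ?Z" using D(2) F(2) y0(1) by auto
      \<comment> \<open>One bound ensures membership in \<open>Gn n\<close>. The other spends half
        of \<open>e\<close> on \<open>F\<close> and leaves the other half for the shift.\<close>
      moreover have "0 < min (?e n / 2) (e / 2)" using F(3) by simp
      ultimately obtain g where g: "g \<in> G" "\<forall>p\<in>?P. dist (g p) (t p) < min (?e n / 2) (e / 2)"
        using adherentD[OF ad] by blast
      have "dist (g (d, \<zero>\<^bsub>Y\<^esub>)) (t (d, \<zero>\<^bsub>Y\<^esub>)) < ?e n" if "d \<in> ?D n" for d
      proof -
        have "dist (g (d, \<zero>\<^bsub>Y\<^esub>)) (t (d, \<zero>\<^bsub>Y\<^esub>)) < ?e n / 2" using g(2) that by auto
        moreover have "0 < ?e n" by simp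
        ultimately show ?thesis by linarith
      qed
      moreover have "dist (g (\<zero>\<^bsub>X\<^esub>, y0)) (t (\<zero>\<^bsub>X\<^esub>, y0)) < ?e n / 2" using g(2) by auto
      ultimately have "g \<in> Gn n" using g(1) by (simp add: Gn_def)
      then have "shift n g \<in> A" by (auto simp: A_def)
      moreover have "dist (shift n g y) (?Y t y) < e" if y: "y \<in> F" for y
      proof -
        have yY: "y \<in> carrier Y" using y F(2) by auto
        have "dist (shift n g y) (?Y t y) = norm (g (\<zero>\<^bsub>X\<^esub>, y) - t (\<zero>\<^bsub>X\<^esub>, y) + of_real (?e n) * \<phi> y)"
          using yY by (simp add: shift_def dist_norm algebra_simps)
        also have "\<dots> \<le> norm (g (\<zero>\<^bsub>X\<^esub>, y) - t (\<zero>\<^bsub>X\<^esub>, y)) + norm (of_real (?e n) * \<phi> y)"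
          by (rule norm_triangle_ineq)
        also have "norm (of_real (?e n) * \<phi> y) = ?e n * norm (\<phi> y)"
          by (simp only: norm_mult norm_of_real) simp
        also have "norm (g (\<zero>\<^bsub>X\<^esub>, y) - t (\<zero>\<^bsub>X\<^esub>, y)) + ?e n * norm (\<phi> y) < e / 2 + e / 2"
        proof (rule add_strict_mono)
          show "norm (g (\<zero>\<^bsub>X\<^esub>, y) - t (\<zero>\<^bsub>X\<^esub>, y)) < e / 2" using g(2) y by (auto simp: dist_norm)
        qed (use n y in blast)
        finally show ?thesis by simp
      qed
      ultimately show "\<exists>a\<in>A. \<forall>y\<in>F. dist (a y) (?Y t y) < e" by blast
    qed
    ultimately have "seq_adherent (carrier Y) A (?Y t)"
      using C B(1) by (intro BFU_spaceD(3)[OF Y, of "C + B"]) auto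
    then obtain s where s: "range s \<subseteq> A" "\<And>y. y \<in> carrier Y \<Longrightarrow> (\<lambda>j. s j y) \<longlonglongrightarrow> ?Y t y"
      unfolding seq_adherent_def by blast
    then have "\<forall>j. \<exists>p. snd p \<in> Gn (fst p) \<and> s j = shift (fst p) (snd p)"
      unfolding A_def by fastforce
    from choice[OF this] obtain p where
      p: "\<And>j. snd (p j) \<in> Gn (fst (p j))" "\<And>j. s j = shift (fst (p j)) (snd (p j))" by blast
    define g N where "g j = snd (p j)" and "N j = fst (p j)" for j
    have g: "g j \<in> G" "\<And>d. d \<in> ?D (N j) \<Longrightarrow> dist (g j (d, \<zero>\<^bsub>Y\<^esub>)) (t (d, \<zero>\<^bsub>Y\<^esub>)) < ?e (N j)"
      "dist (g j (\<zero>\<^bsub>X\<^esub>, y0)) (t (\<zero>\<^bsub>X\<^esub>, y0)) < ?e (N j) / 2" for j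
      using p(1)[of j] by (auto simp: g_def N_def Gn_def)
    have s_eq: "s j y = g j (\<zero>\<^bsub>X\<^esub>, y) + of_real (?e (N j)) * \<phi> y" if "y \<in> carrier Y" for j y
      using that by (simp add: p(2) shift_def g_def N_def)
    \<comment> \<open>At \<open>y0\<close> the shift contributes \<open>?e (N j)\<close> and the
      approximation error cancels less than half of it.\<close>
    have e_le: "?e (N j) \<le> 2 * dist (s j y0) (?Y t y0)" for j
    proof -
      have "s j y0 - t (\<zero>\<^bsub>X\<^esub>, y0) = of_real (?e (N j)) - (t (\<zero>\<^bsub>X\<^esub>, y0) - g j (\<zero>\<^bsub>X\<^esub>, y0))"
        using s_eq[OF y0(1)] y0(2) by simp
      then have "norm (of_real (?e (N j)) :: 'k) - norm (t (\<zero>\<^bsub>X\<^esub>, y0) - g j (\<zero>\<^bsub>X\<^esub>, y0)) \<le>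
          norm (s j y0 - t (\<zero>\<^bsub>X\<^esub>, y0))"
        by (metis norm_triangle_ineq2)
      moreover have "norm (of_real (?e (N j)) :: 'k) = ?e (N j)" by (simp only: norm_of_real) simp
      ultimately show ?thesis
        using g(3)[of j] y0(1) by (simp add: dist_norm norm_minus_commute)
    qed
    have e_lim: "(\<lambda>j. ?e (N j)) \<longlonglongrightarrow> 0"
    proof (rule Lim_null_comparison)
      show "\<forall>\<^sub>F j in sequentially. norm (?e (N j)) \<le> 2 * dist (s j y0) (?Y t y0)"
        using e_le by simp
      show "(\<lambda>j. 2 * dist (s j y0) (?Y t y0)) \<longlonglongrightarrow> 0"
        by (intro tendsto_mult_right_zero tendsto_dist_iff[THEN iffD1] s(2) y0(1))
    qed
    show ?thesis
    proof (rule glue[OF g(1)])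
      fix d assume d: "d \<in> D"
      show "(\<lambda>j. g j (d, \<zero>\<^bsub>Y\<^esub>)) \<longlonglongrightarrow> t (d, \<zero>\<^bsub>Y\<^esub>)"
        unfolding tendsto_dist_iff[of _ "t (d, \<zero>\<^bsub>Y\<^esub>)"]
      proof (rule Lim_null_comparison[OF _ e_lim])
        have "\<forall>\<^sub>F j in sequentially. ?e (N j) < ?e (k d)"
          using e_lim by (intro order_tendstoD(2)) auto
        then show "\<forall>\<^sub>F j in sequentially. norm (dist (g j (d, \<zero>\<^bsub>Y\<^esub>)) (t (d, \<zero>\<^bsub>Y\<^esub>))) \<le> ?e (N j)"
        proof eventually_elim
          case (elim j)
          \<comment> \<open>From here on \<open>d\<close> is among the points that membership in
            \<open>Gn (N j)\<close> controls.\<close>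
          then have "k d \<le> N j" by (simp add: field_simps)
          then show ?case using g(2)[of d j] d by (simp add: less_imp_le)
        qed
      qed
    next
      fix y assume y: "y \<in> carrier Y"
      have "(\<lambda>j. of_real (?e (N j)) * \<phi> y) \<longlonglongrightarrow> of_real 0 * \<phi> y"
        by (intro tendsto_intros e_lim)
      then have "(\<lambda>j. s j y - of_real (?e (N j)) * \<phi> y) \<longlonglongrightarrow> ?Y t y - 0"
        using s(2)[OF y] by (intro tendsto_diff) simp_all
      then show "(\<lambda>j. g j (\<zero>\<^bsub>X\<^esub>, y)) \<longlonglongrightarrow> t (\<zero>\<^bsub>X\<^esub>, y)"
        using y by (simp add: s_eq[OF y])
    qed
  qed
qed

section \<open>Finite products and reflexive spaces\<close>

lemma finite_prod_space_simps [simp]: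
  "carrier (finite_prod_space I X) = (\<Pi>\<^sub>E i\<in>I. carrier (X i))"
  "zero (finite_prod_space I X) = (\<lambda>i\<in>I. zero (X i))"
  "add (finite_prod_space I X) x y = (\<lambda>i\<in>I. add (X i) (x i) (y i))"
  "smult (finite_prod_space I X) c x = (\<lambda>i\<in>I. smult (X i) c (x i))"
  by (simp_all add: finite_prod_space_def)

lemma finite_prod_nrm_le_iff:
  "finite I \<Longrightarrow> nrm (finite_prod_space I X) x \<le> c \<longleftrightarrow> 0 \<le> c \<and> (\<forall>i\<in>I. nrm (X i) (x i) \<le> c)"
  by (simp add: finite_prod_space_def)

lemma finite_prod_nrm_less_iff:
  "finite I \<Longrightarrow> nrm (finite_prod_space I X) x < c \<longleftrightarrow> 0 < c \<and> (\<forall>i\<in>I. nrm (X i) (x i) < c)"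
  by (simp add: finite_prod_space_def)

lemma finite_prod_nrm_nonneg: "finite I \<Longrightarrow> 0 \<le> nrm (finite_prod_space I X) x"
  using finite_prod_nrm_le_iff[of I X x "nrm (finite_prod_space I X) x"] by simp

lemma finite_prod_nrm_component:
  "finite I \<Longrightarrow> i \<in> I \<Longrightarrow> nrm (X i) (x i) \<le> nrm (finite_prod_space I X) x"
  using finite_prod_nrm_le_iff[of I X x "nrm (finite_prod_space I X) x"] by simp

lemma normed_space_finite_prod:
  assumes I: "finite I" and N: "\<And>i. i \<in> I \<Longrightarrow> normed_space (X i)"
  shows "normed_space (finite_prod_space I X)"
proof -
  let ?P = "finite_prod_space I X"
  have ext: "x = y" if "x \<in> carrier ?P" "y \<in> carrier ?P" "\<And>i. i \<in> I \<Longrightarrow> x i = y i" for x y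
    using that by (intro extensionalityI[of x I y]) (auto simp: PiE_def)
  have add: "add ?P x y \<in> carrier ?P" if "x \<in> carrier ?P" "y \<in> carrier ?P" for x y
  proof -
    have "add (X i) (x i) (y i) \<in> carrier (X i)" if i: "i \<in> I" for i
    proof -
      interpret normed_space "X i" by (rule N[OF i])
      show ?thesis using \<open>x \<in> carrier ?P\<close> \<open>y \<in> carrier ?P\<close> i by auto
    qed
    then show ?thesis by auto
  qed
  have smult: "smult ?P c x \<in> carrier ?P" if "x \<in> carrier ?P" for c x
  proof -
    have "smult (X i) c (x i) \<in> carrier (X i)" if i: "i \<in> I" for i
      using normed_space.smult_in[OF N[OF i]] \<open>x \<in> carrier ?P\<close> i by auto
    then show ?thesis by auto
  qed
  have zero: "zero ?P \<in> carrier ?P"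
  proof -
    have "zero (X i) \<in> carrier (X i)" if i: "i \<in> I" for i
    proof -
      interpret normed_space "X i" by (rule N[OF i])
      show ?thesis by simp
    qed
    then show ?thesis by auto
  qed
  note closed = add smult zero
  show ?thesis
  proof (rule normed_spaceI)
    fix x y z assume x: "x \<in> carrier ?P" and y: "y \<in> carrier ?P" and z: "z \<in> carrier ?P"
    show "add ?P (add ?P x y) z = add ?P x (add ?P y z)"
    proof (rule ext)
      fix i assume i: "i \<in> I"
      interpret normed_space "X i" by (rule N[OF i])
      show "add ?P (add ?P x y) z i = add ?P x (add ?P y z) i"
        using M.a_assoc[of "x i" "y i" "z i"] x y z i by auto
    qed (intro closed x y z)+
  next
    fix x y assume x: "x \<in> carrier ?P" and y: "y \<in> carrier ?P"
    show "add ?P x y = add ?P y x"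
    proof (rule ext)
      fix i assume i: "i \<in> I"
      interpret normed_space "X i" by (rule N[OF i])
      show "add ?P x y i = add ?P y x i" using M.a_comm[of "x i" "y i"] x y i by auto
    qed (intro closed x y)+
    show "smult ?P c (add ?P x y) = add ?P (smult ?P c x) (smult ?P c y)" for c
    proof (rule ext)
      fix i assume i: "i \<in> I"
      interpret normed_space "X i" by (rule N[OF i])
      show "smult ?P c (add ?P x y) i = add ?P (smult ?P c x) (smult ?P c y) i"
        using r_distr[of "x i" "y i" c] x y i by auto
    qed (intro closed x y)+
    have "nrm (X i) (add ?P x y i) \<le> nrm ?P x + nrm ?P y" if i: "i \<in> I" for i
    proof -
      interpret normed_space "X i" by (rule N[OF i])
      have "x i \<in> carrier (X i)" "y i \<in> carrier (X i)" using x y i by auto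
      from nrm_triangle[OF this] show ?thesis
        using finite_prod_nrm_component[OF I i, of X x] finite_prod_nrm_component[OF I i, of X y] i
        by simp
    qed
    then show "nrm ?P (add ?P x y) \<le> nrm ?P x + nrm ?P y"
      unfolding finite_prod_nrm_le_iff[OF I] using finite_prod_nrm_nonneg[OF I, of X]
      by (auto intro: add_nonneg_nonneg)
  next
    fix x assume x: "x \<in> carrier ?P"
    have xi: "x i \<in> carrier (X i)" if "i \<in> I" for i using x that by auto
    show "smult ?P 0 x = zero ?P"
    proof (rule ext)
      fix i assume i: "i \<in> I"
      interpret normed_space "X i" by (rule N[OF i])
      show "smult ?P 0 x i = zero ?P i" using xi[OF i] i by simp
    qed (intro closed x)+
    show "smult ?P 1 x = x"
    proof (rule ext)
      fix i assume i: "i \<in> I"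
      interpret normed_space "X i" by (rule N[OF i])
      show "smult ?P 1 x i = x i" using xi[OF i] i by simp
    qed (intro closed x)+
    show "smult ?P (c + d) x = add ?P (smult ?P c x) (smult ?P d x)" for c d
    proof (rule ext)
      fix i assume i: "i \<in> I"
      interpret normed_space "X i" by (rule N[OF i])
      show "smult ?P (c + d) x i = add ?P (smult ?P c x) (smult ?P d x) i"
        using xi[OF i] i by (simp add: l_distr)
    qed (intro closed x)+
    show "smult ?P (c * d) x = smult ?P c (smult ?P d x)" for c d
    proof (rule ext)
      fix i assume i: "i \<in> I"
      interpret normed_space "X i" by (rule N[OF i])
      show "smult ?P (c * d) x i = smult ?P c (smult ?P d x) i"
        using xi[OF i] i by (simp add: smult_assoc)
    qed (intro closed x)+
    have nrm_i: "nrm (X i) (x i) = 0 \<longleftrightarrow> x i = zero (X i)" "0 \<le> nrm (X i) (x i)"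
      "nrm (X i) (smult (X i) c (x i)) = norm c * nrm (X i) (x i)" if i: "i \<in> I" for i c
    proof -
      interpret normed_space "X i" by (rule N[OF i])
      show "nrm (X i) (x i) = 0 \<longleftrightarrow> x i = zero (X i)" "0 \<le> nrm (X i) (x i)"
        "nrm (X i) (smult (X i) c (x i)) = norm c * nrm (X i) (x i)"
        using nrm_eq_0[OF xi[OF i]] nrm_nonneg[OF xi[OF i]] nrm_smult[OF xi[OF i]] by auto
    qed
    show "nrm ?P x = 0 \<longleftrightarrow> x = zero ?P"
    proof
      assume 0: "nrm ?P x = 0"
      show "x = zero ?P"
      proof (rule ext[OF x zero])
        fix i assume i: "i \<in> I"
        then have "nrm (X i) (x i) = 0"
          using finite_prod_nrm_component[OF I i, of X x] 0 nrm_i(2)[OF i] by simp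
        then show "x i = zero ?P i" using nrm_i(1)[OF i] i by simp
      qed
    next
      assume x0: "x = zero ?P"
      have "nrm (X i) (x i) \<le> 0" if i: "i \<in> I" for i using nrm_i(1)[OF i] i by (simp add: x0)
      then have "nrm ?P x \<le> 0" unfolding finite_prod_nrm_le_iff[OF I] by simp
      then show "nrm ?P x = 0" using finite_prod_nrm_nonneg[OF I, of X x] by simp
    qed
    show "nrm ?P (smult ?P c x) = norm c * nrm ?P x" for c
    proof (rule antisym)
      show "nrm ?P (smult ?P c x) \<le> norm c * nrm ?P x"
        unfolding finite_prod_nrm_le_iff[OF I]
        using finite_prod_nrm_nonneg[OF I, of X x] finite_prod_nrm_component[OF I, of _ X x] nrm_i(3)
        by (auto intro: mult_left_mono)
      \<comment> \<open>The maximum is attained, either at the inserted 0 or at a component. This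
        gives the inequality that the componentwise estimate does not.\<close>
      have "nrm ?P x \<in> insert 0 ((\<lambda>i. nrm (X i) (x i)) ` I)"
        using I Max_in[of "insert 0 ((\<lambda>i. nrm (X i) (x i)) ` I)"]
        by (simp only: finite_prod_space_def normed_module.select_convs finite_insert finite_imageI) simp
      then consider "nrm ?P x = 0" | i where "i \<in> I" "nrm ?P x = nrm (X i) (x i)" by auto
      then show "norm c * nrm ?P x \<le> nrm ?P (smult ?P c x)"
      proof cases
        case 1
        then show ?thesis using finite_prod_nrm_nonneg[OF I, of X "smult ?P c x"] by simp
      next
        case (2 i)
        then show ?thesis
          using finite_prod_nrm_component[OF I 2(1), of X "smult ?P c x"] nrm_i(3)[OF 2(1), of c]
          by simp
      qed
    qed
  qed (intro closed; assumption)+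
qed

lemma finite_prod_minus:
  assumes I: "finite I" and N: "\<And>i. i \<in> I \<Longrightarrow> normed_space (X i)"
    and x: "x \<in> carrier (finite_prod_space I X)" and y: "y \<in> carrier (finite_prod_space I X)"
    and i: "i \<in> I"
  shows "(x \<ominus>\<^bsub>finite_prod_space I X\<^esub> y) i = x i \<ominus>\<^bsub>X i\<^esub> y i"
proof -
  interpret P: normed_space "finite_prod_space I X" using I N by (rule normed_space_finite_prod)
  interpret normed_space "X i" by (rule N[OF i])
  have "x i \<in> carrier (X i)" "y i \<in> carrier (X i)" using x y i by auto
  then show ?thesis using i by (simp add: P.minus_eq[OF x y] minus_eq)
qed

lemma banach_space_finite_prod:
  assumes I: "finite I" and B: "\<And>i. i \<in> I \<Longrightarrow> banach_space (X i)"
  shows "banach_space (finite_prod_space I X)"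
  unfolding banach_space_iff
proof (intro conjI allI impI)
  let ?P = "finite_prod_space I X"
  have N: "normed_space (X i)" if "i \<in> I" for i using B[OF that] by (simp add: banach_space_def)
  show "normed_space ?P" using I N by (rule normed_space_finite_prod)
  fix \<sigma> :: "nat \<Rightarrow> _" assume ran: "range \<sigma> \<subseteq> carrier ?P"
    and cau: "\<forall>e>0. \<exists>M. \<forall>m\<ge>M. \<forall>n\<ge>M. nrm ?P (\<sigma> m \<ominus>\<^bsub>?P\<^esub> \<sigma> n) < e"
  have \<sigma>: "\<sigma> n \<in> carrier ?P" for n using ran by (rule range_subsetD)
  have "\<exists>y. y \<in> carrier (X i) \<and> (\<lambda>n. nrm (X i) (\<sigma> n i \<ominus>\<^bsub>X i\<^esub> y)) \<longlonglongrightarrow> 0" if i: "i \<in> I" for i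
  proof -
    have si: "\<sigma> n i \<in> carrier (X i)" for n using \<sigma>[of n] i by auto
    have c: "\<exists>M. \<forall>m\<ge>M. \<forall>n\<ge>M. nrm (X i) (\<sigma> m i \<ominus>\<^bsub>X i\<^esub> \<sigma> n i) < e" if e: "0 < e" for e
    proof -
      obtain M where M: "\<forall>m\<ge>M. \<forall>n\<ge>M. nrm ?P (\<sigma> m \<ominus>\<^bsub>?P\<^esub> \<sigma> n) < e" using cau e by blast
      have "nrm (X i) (\<sigma> m i \<ominus>\<^bsub>X i\<^esub> \<sigma> n i) < e" if "M \<le> m" "M \<le> n" for m n
        using finite_prod_nrm_component[OF I i, of X "\<sigma> m \<ominus>\<^bsub>?P\<^esub> \<sigma> n"] M that
          finite_prod_minus[OF I N \<sigma> \<sigma> i, of m n] by fastforce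
      then show ?thesis by blast
    qed
    show ?thesis by (rule banach_space_limit[OF B[OF i] si c]) blast+
  qed
  then have "\<forall>i. \<exists>y. i \<in> I \<longrightarrow> y \<in> carrier (X i) \<and> (\<lambda>n. nrm (X i) (\<sigma> n i \<ominus>\<^bsub>X i\<^esub> y)) \<longlonglongrightarrow> 0"
    by blast
  from choice[OF this] obtain y where
    y: "\<And>i. i \<in> I \<Longrightarrow> y i \<in> carrier (X i)" "\<And>i. i \<in> I \<Longrightarrow> (\<lambda>n. nrm (X i) (\<sigma> n i \<ominus>\<^bsub>X i\<^esub> y i)) \<longlonglongrightarrow> 0"
    by blast
  let ?y = "\<lambda>i\<in>I. y i"
  have yP: "?y \<in> carrier ?P" using y(1) by auto
  show "\<exists>z\<in>carrier ?P. (\<lambda>n. nrm ?P (\<sigma> n \<ominus>\<^bsub>?P\<^esub> z)) \<longlonglongrightarrow> 0"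
  proof (intro bexI[OF _ yP] tendstoI)
    fix e :: real assume e: "0 < e"
    have "\<forall>\<^sub>F n in sequentially. \<forall>i\<in>I. nrm (X i) (\<sigma> n i \<ominus>\<^bsub>X i\<^esub> y i) < e"
      using y(2) e by (intro eventually_ball_finite I ballI order_tendstoD(2)[of _ 0]) auto
    then show "\<forall>\<^sub>F n in sequentially. dist (nrm ?P (\<sigma> n \<ominus>\<^bsub>?P\<^esub> ?y)) 0 < e"
    proof eventually_elim
      case (elim n)
      have "nrm ?P (\<sigma> n \<ominus>\<^bsub>?P\<^esub> ?y) < e"
        unfolding finite_prod_nrm_less_iff[OF I]
        using elim e finite_prod_minus[OF I N \<sigma>[of n] yP] by auto
      then show ?case using finite_prod_nrm_nonneg[OF I, of X] by (simp add: dist_norm)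
    qed
  qed
qed

text \<open>Approximating each coordinate within \<open>e\<close> approximates in the maximum norm,
  and a finite product of countable dense sets is countable.\<close>

lemma separable_banach_space_finite_prod:
  assumes I: "finite I" and S: "\<And>i. i \<in> I \<Longrightarrow> separable_banach_space (X i)"
  shows "separable_banach_space (finite_prod_space I X)"
proof -
  let ?P = "finite_prod_space I X"
  have B: "banach_space (X i)" and N: "normed_space (X i)" if "i \<in> I" for i
    using S[OF that] by (auto simp: separable_banach_space_def banach_space_def)
  have "\<forall>i. \<exists>D. i \<in> I \<longrightarrow> countable D \<and> D \<subseteq> carrier (X i) \<and>
      (\<forall>x\<in>carrier (X i). \<forall>e>0. \<exists>d\<in>D. nrm (X i) (x \<ominus>\<^bsub>X i\<^esub> d) < e)"
    using S[unfolded separable_banach_space_iff, THEN conjunct2] by simp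
  from choice[OF this] obtain D where
    "\<forall>i. i \<in> I \<longrightarrow> countable (D i) \<and> D i \<subseteq> carrier (X i) \<and>
      (\<forall>x\<in>carrier (X i). \<forall>e>0. \<exists>d\<in>D i. nrm (X i) (x \<ominus>\<^bsub>X i\<^esub> d) < e)" ..
  then have D: "\<And>i. i \<in> I \<Longrightarrow> countable (D i)" "\<And>i. i \<in> I \<Longrightarrow> D i \<subseteq> carrier (X i)"
    "\<And>i x e. i \<in> I \<Longrightarrow> x \<in> carrier (X i) \<Longrightarrow> 0 < e \<Longrightarrow> \<exists>d\<in>D i. nrm (X i) (x \<ominus>\<^bsub>X i\<^esub> d) < e"
    by simp_all
  have sub: "PiE I D \<subseteq> carrier ?P" using D(2) by (auto intro!: PiE_mono)
  have "\<exists>d\<in>PiE I D. nrm ?P (x \<ominus>\<^bsub>?P\<^esub> d) < e" if x: "x \<in> carrier ?P" and e: "0 < e" for x e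
  proof -
    have "\<forall>i. \<exists>d. i \<in> I \<longrightarrow> d \<in> D i \<and> nrm (X i) (x i \<ominus>\<^bsub>X i\<^esub> d) < e"
    proof
      fix i
      show "\<exists>d. i \<in> I \<longrightarrow> d \<in> D i \<and> nrm (X i) (x i \<ominus>\<^bsub>X i\<^esub> d) < e"
      proof (cases "i \<in> I")
        case True
        then have "x i \<in> carrier (X i)" using x by auto
        from D(3)[OF True this e] show ?thesis by blast
      qed simp
    qed
    from choice[OF this] obtain d where
      d: "\<And>i. i \<in> I \<Longrightarrow> d i \<in> D i" "\<And>i. i \<in> I \<Longrightarrow> nrm (X i) (x i \<ominus>\<^bsub>X i\<^esub> d i) < e"
      by blast
    let ?d = "\<lambda>i\<in>I. d i"
    have dP: "?d \<in> PiE I D" using d(1) by auto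
    then have "?d \<in> carrier ?P" using sub by blast
    then have "nrm ?P (x \<ominus>\<^bsub>?P\<^esub> ?d) < e"
      unfolding finite_prod_nrm_less_iff[OF I]
      using d(2) e finite_prod_minus[OF I N x] by auto
    then show ?thesis using dP by blast
  qed
  moreover have "countable (PiE I D)" using I D(1) by (rule countable_PiE)
  moreover have "banach_space ?P" using I B by (rule banach_space_finite_prod)
  ultimately show ?thesis
    unfolding separable_banach_space_iff using sub by blast
qed

section \<open>Compact absorbing sets and Alaoglu's theorem\<close>

text \<open>A substitute for weak compactness of the unit ball that passes to finite products by Tychonoff's
  theorem: the compact topology need not be the weak one and may live on a larger set.\<close>

definition weakly_compact_ball ::
    "('k::{real_normed_field, euclidean_space}, 'a) normed_module \<Rightarrow> bool" where
  "weakly_compact_ball X \<longleftrightarrow>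
     (\<exists>K. compact_space K \<and> topspace K \<subseteq> carrier X \<and>
        (\<forall>x\<in>carrier X. nrm X x \<le> 1 \<longrightarrow> x \<in> topspace K) \<and>
        (\<forall>f\<in>bounded_linear_maps X scalar_space. continuous_map K euclidean f))"

text \<open>Alaoglu's theorem: the ball is closed in a product of closed balls of scalars, which are
  compact in finite dimension, and Tychonoff's theorem applies. Asking only for closure under the
  operations lets the same lemma serve for the dual in place of \<open>X\<close>.\<close>

lemma compactin_dual_ball:
  fixes X :: "('k::{real_normed_field, euclidean_space}, 'a) normed_module"
  assumes add: "\<And>x y. x \<in> carrier X \<Longrightarrow> y \<in> carrier X \<Longrightarrow> x \<oplus>\<^bsub>X\<^esub> y \<in> carrier X"
    and smult: "\<And>c x. x \<in> carrier X \<Longrightarrow> c \<odot>\<^bsub>X\<^esub> x \<in> carrier X"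
  shows "compactin (product_topology (\<lambda>_. euclidean) (carrier X)) (dual_ball X C)"
proof -
  let ?P = "product_topology (\<lambda>_. euclidean) (carrier X) :: ('a \<Rightarrow> 'k) topology"
  let ?A = "\<lambda>(x, y). {f \<in> topspace ?P. f (x \<oplus>\<^bsub>X\<^esub> y) = f x + f y}"
  let ?S = "\<lambda>(c, x). {f \<in> topspace ?P. f (c \<odot>\<^bsub>X\<^esub> x) = c * f x}"
  let ?N = "\<lambda>x. {f \<in> topspace ?P. dist (f x) 0 \<le> C * nrm X x}"
  \<comment> \<open>The whole space keeps the family nonempty even for an empty carrier.\<close>
  let ?F = "{topspace ?P} \<union> ?A ` (carrier X \<times> carrier X) \<union> ?S ` (UNIV \<times> carrier X) \<union> ?N ` carrier X"
  have proj: "continuous_map ?P euclidean (\<lambda>f. f x)" if "x \<in> carrier X" for x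
    using that by (rule continuous_map_product_projection)
  have proj_mult: "continuous_map ?P euclidean (\<lambda>f. c * f x)" if "x \<in> carrier X" for x c
  proof -
    have "continuous_map euclidean euclidean (\<lambda>z :: 'k. c * z)" by (auto intro!: continuous_intros)
    from continuous_map_compose[OF proj[OF that] this] show ?thesis by (simp add: o_def)
  qed
  have "closedin ?P (\<Inter>?F)"
  proof (rule closedin_Inter)
    fix S assume "S \<in> ?F"
    then consider "S = topspace ?P" | x y where "x \<in> carrier X" "y \<in> carrier X" "S = ?A (x, y)"
      | c x where "x \<in> carrier X" "S = ?S (c, x)" | x where "x \<in> carrier X" "S = ?N x"
      by blast
    then show "closedin ?P S"
    proof cases
      case 1
      show ?thesis unfolding 1 by (rule closedin_topspace)
    next
      case 2
      then show ?thesis unfolding 2(3) prod.case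
        by (intro closedin_equal continuous_map_add proj add)
    next
      case 3
      then show ?thesis unfolding 3(2) prod.case
        by (intro closedin_equal proj proj_mult smult)
    next
      case 4
      then show ?thesis unfolding 4(2) by (intro closedin_dist_le proj) auto
    qed
  qed blast
  moreover have "\<Inter>?F = dual_ball X C"
    by (auto simp: dual_ball_def PiE_def)
  ultimately have "closedin ?P (dual_ball X C)" by simp
  moreover have "compactin ?P (\<Pi>\<^sub>E x\<in>carrier X. cball 0 (C * nrm X x))"
    by (simp add: compactin_PiE)
  moreover have "dual_ball X C \<subseteq> (\<Pi>\<^sub>E x\<in>carrier X. cball 0 (C * nrm X x))"
    by (auto simp: dual_ball_def PiE_def)
  ultimately show ?thesis by (metis closed_compactin)
qed

text \<open>Evaluation of functionals from the ball at points of \<open>K\<close> is continuous in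
  each variable, and both sides are compact, the second by Alaoglu's theorem. Homogeneity extends
  the convergence from \<open>K\<close> to all vectors.\<close>

lemma BFU_space_weakly_compact_ball:
  assumes B: "banach_space X" and W: "weakly_compact_ball X"
  shows "BFU_space X"
proof (rule BFU_spaceI[OF B])
  interpret normed_space X using B by (simp add: banach_space_def)
  obtain K where K: "compact_space K" "topspace K \<subseteq> carrier X"
    "\<And>x. x \<in> carrier X \<Longrightarrow> nrm X x \<le> 1 \<Longrightarrow> x \<in> topspace K"
    "\<And>f. f \<in> bounded_linear_maps X scalar_space \<Longrightarrow> continuous_map K euclidean f"
    using W unfolding weakly_compact_ball_def by blast
  fix C G t assume C: "0 \<le> C" and G: "G \<subseteq> dual_ball X C" "t \<in> dual_ball X C"
    and ad: "adherent (carrier X) G t"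
  let ?P = "product_topology (\<lambda>_. euclidean) (carrier X)"
  let ?L = "subtopology ?P (dual_ball X C)"
  have comp: "compactin ?P (dual_ball X C)" by (rule compactin_dual_ball) auto
  have top: "topspace ?L = dual_ball X C"
    using dual_ball_subset_extensional[of X C] by (auto simp: PiE_def)
  have "seq_adherent (topspace K) G t"
  proof (rule seq_adherent_if_compact[OF K(1) compact_space_subtopology[OF comp]])
    show "continuous_map K euclidean f" if "f \<in> topspace ?L" for f
      using that K(4) unfolding top functional_iff_dual_ball by blast
    show "continuous_map ?L euclidean (\<lambda>f. f x)" if "x \<in> topspace K" for x
      using that K(2) by (intro continuous_map_from_subtopology continuous_map_product_projection) auto
    show "adherent (topspace K) G t" using ad K(2) unfolding adherent_def by (meson order_trans)
  qed (simp_all only: top G)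
  then obtain s where s: "range s \<subseteq> G" "\<And>x. x \<in> topspace K \<Longrightarrow> (\<lambda>n. s n x) \<longlonglongrightarrow> t x"
    unfolding seq_adherent_def by blast
  have sB: "s n \<in> dual_ball X C" for n using s(1) G(1) by auto
  have "(\<lambda>n. s n x) \<longlonglongrightarrow> t x" if x: "x \<in> carrier X" for x
  proof (cases "nrm X x = 0")
    case True
    then have "x \<in> topspace K" using K(3)[OF x] by simp
    then show ?thesis by (rule s(2))
  next
    case False
    \<comment> \<open>Every nonzero vector is a multiple of a unit vector, and unit vectors belong
      to \<open>K\<close>.\<close>
    let ?c = "of_real (nrm X x)" and ?u = "of_real (inverse (nrm X x)) \<odot>\<^bsub>X\<^esub> x"
    have u: "?u \<in> carrier X" "?u \<in> topspace K"
      using x smult_unit_ball[OF x False] by (auto intro!: K(3))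
    have "f x = ?c * f ?u" if "f \<in> dual_ball X C" for f
      unfolding dual_ballD(3)[OF that x] using False by (simp add: mult.assoc[symmetric])
    then show ?thesis
      using tendsto_mult_left[OF s(2)[OF u(2)], of ?c] sB G(2) by simp
  qed
  then show "seq_adherent (carrier X) G t" using s(1) unfolding seq_adherent_def by blast
qed

text \<open>Open sets upstairs are preimages, so an open cover of \<open>A\<close> comes from one of
  its image. Points may be identified by \<open>h\<close>, which matters because the canonical
  embedding is not shown to be injective.\<close>

lemma compact_space_pullback_topology:
  assumes comp: "compactin T (h ` A)"
  shows "compact_space (pullback_topology A h T)"
  unfolding compact_space_alt
proof (intro allI impI; elim conjE)
  have top: "topspace (pullback_topology A h T) = A"
    using compactin_subset_topspace[OF comp] by (auto simp: topspace_pullback_topology)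
  fix \<U> assume op: "\<forall>U\<in>\<U>. openin (pullback_topology A h T) U"
    and cover: "topspace (pullback_topology A h T) \<subseteq> \<Union>\<U>"
  let ?\<V> = "{V. openin T V \<and> h -` V \<inter> A \<in> \<U>}"
  have "h ` A \<subseteq> \<Union>?\<V>"
  proof
    fix y assume "y \<in> h ` A"
    then obtain x where x: "x \<in> A" "y = h x" by blast
    then obtain U where U: "U \<in> \<U>" "x \<in> U" using cover top by auto
    then obtain V where V: "openin T V" "U = h -` V \<inter> A"
      using bspec[OF op U(1)] unfolding openin_pullback_topology by blast
    then show "y \<in> \<Union>?\<V>" using U x by blast
  qed
  then have "\<exists>\<F>. finite \<F> \<and> \<F> \<subseteq> ?\<V> \<and> h ` A \<subseteq> \<Union>\<F>"
    by (intro compactinD[OF comp]) auto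
  then obtain \<F> where \<F>: "finite \<F>" "\<F> \<subseteq> ?\<V>" "h ` A \<subseteq> \<Union>\<F>" by (elim exE conjE)
  have "A \<subseteq> \<Union>((\<lambda>V. h -` V \<inter> A) ` \<F>)" using \<F>(3) by auto
  then show "\<exists>\<F>. finite \<F> \<and> \<F> \<subseteq> \<U> \<and> topspace (pullback_topology A h T) \<subseteq> \<Union>\<F>"
    using \<F>(1,2) by (intro exI[of _ "(\<lambda>V. h -` V \<inter> A) ` \<F>"]) (auto simp: top)
qed

text \<open>Without the Hahn-Banach theorem the canonical embedding is not known to be isometric, so the
  preimage of the unit ball of the bidual may be larger than the unit ball; it is compact in the
  topology of pointwise convergence by Alaoglu's theorem, and this is all that is needed.\<close>

lemma weakly_compact_ball_reflexive:
  fixes X :: "('k::{real_normed_field, euclidean_space}, 'a) normed_module"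
  assumes R: "reflexive_banach_space X"
  shows "weakly_compact_ball X"
proof -
  interpret normed_space X using R by (simp add: reflexive_banach_space_def banach_space_def)
  let ?D = "dual_space X" and ?J = "canonical_embedding X"
  let ?P = "product_topology (\<lambda>_. euclidean) (carrier ?D) :: (('a \<Rightarrow> 'k) \<Rightarrow> 'k) topology"
  define B where "B = {x \<in> carrier X. ?J x \<in> dual_ball ?D 1}"
  have J: "?J ` carrier X = bounded_linear_maps ?D scalar_space"
    using R by (simp add: reflexive_banach_space_def carrier_dual_space)
  have ball: "x \<in> B" if x: "x \<in> carrier X" "nrm X x \<le> 1" for x
  proof -
    have "?J x \<in> bounded_linear_maps ?D scalar_space" using x(1) J by blast
    then obtain C where "?J x \<in> dual_ball ?D C" unfolding functional_iff_dual_ball by blast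
    moreover have "norm (?J x f) \<le> nrm ?D f" if "f \<in> carrier ?D" for f
      using norm_le_dual_nrm[of f x] x that by (simp add: canonical_embedding_def carrier_dual_space)
    ultimately show ?thesis using x(1) by (simp add: B_def dual_ball_def)
  qed
  \<comment> \<open>Alaoglu's theorem is about to be applied to the dual, which must be closed under
    its operations.\<close>
  have add: "f \<oplus>\<^bsub>?D\<^esub> g \<in> carrier ?D" if fg: "f \<in> carrier ?D" "g \<in> carrier ?D" for f g
  proof -
    obtain C C' where C: "f \<in> dual_ball X C" "g \<in> dual_ball X C'"
      using fg unfolding carrier_dual_space functional_iff_dual_ball by blast
    have "(\<lambda>x\<in>carrier X. f x + g x) \<in> dual_ball X (C + C')"
    proof (rule dual_ballI)
      show "norm ((\<lambda>x\<in>carrier X. f x + g x) x) \<le> (C + C') * nrm X x" if "x \<in> carrier X" for x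
        using norm_triangle_mono[OF dual_ballD(4)[OF C(1) that] dual_ballD(4)[OF C(2) that]] that
        by (simp add: distrib_right)
    qed (simp_all add: dual_ballD[OF C(1)] dual_ballD[OF C(2)] distrib_left)
    then show ?thesis
      unfolding carrier_dual_space functional_iff_dual_ball by (auto simp: dual_space_def)
  qed
  have smult: "c \<odot>\<^bsub>?D\<^esub> f \<in> carrier ?D" if f: "f \<in> carrier ?D" for c f
  proof -
    obtain C where C: "f \<in> dual_ball X C"
      using f unfolding carrier_dual_space functional_iff_dual_ball by blast
    have "(\<lambda>x\<in>carrier X. c * f x) \<in> dual_ball X (norm c * C)"
    proof (rule dual_ballI)
      show "norm ((\<lambda>x\<in>carrier X. c * f x) x) \<le> norm c * C * nrm X x" if "x \<in> carrier X" for x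
        using mult_left_mono[OF dual_ballD(4)[OF C that] norm_ge_zero[of c]] that
        by (simp add: norm_mult mult.assoc)
    qed (simp_all add: dual_ballD[OF C] distrib_left mult.left_commute)
    then show ?thesis
      unfolding carrier_dual_space functional_iff_dual_ball by (auto simp: dual_space_def)
  qed
  \<comment> \<open>Reflexivity enters here: every element of the bidual ball is the image of some
    vector, which then lies in \<open>B\<close> by definition.\<close>
  have "?J ` B = dual_ball ?D 1"
  proof
    show "dual_ball ?D 1 \<subseteq> ?J ` B"
    proof
      fix F assume F: "F \<in> dual_ball ?D 1"
      then have "F \<in> ?J ` carrier X" unfolding J functional_iff_dual_ball by blast
      then show "F \<in> ?J ` B" using F by (auto simp: B_def)
    qed
  qed (auto simp: B_def)
  then have comp: "compactin ?P (?J ` B)"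
    using compactin_dual_ball[OF add smult, of 1] by simp
  let ?K = "pullback_topology B ?J ?P"
  have top: "topspace ?K = B"
    using compactin_subset_topspace[OF comp] by (auto simp: topspace_pullback_topology)
  have "compact_space ?K" using comp by (rule compact_space_pullback_topology)
  moreover have "continuous_map ?K euclidean f" if f: "f \<in> bounded_linear_maps X scalar_space" for f
  proof -
    \<comment> \<open>The functional \<open>f\<close> is the embedding followed by the coordinate
      projection at \<open>f\<close>.\<close>
    have "continuous_map ?P euclidean (\<lambda>F. F f)"
      using f by (intro continuous_map_product_projection) (simp add: carrier_dual_space)
    then have "continuous_map ?K euclidean ((\<lambda>F. F f) \<circ> ?J)"
      by (rule continuous_map_pullback)
    moreover have "(\<lambda>F. F f) \<circ> ?J = f"
      using f by (simp add: fun_eq_iff canonical_embedding_def carrier_dual_space)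
    ultimately show ?thesis by simp
  qed
  moreover have "B \<subseteq> carrier X" by (auto simp: B_def)
  ultimately show ?thesis
    unfolding weakly_compact_ball_def using ball by (intro exI[of _ ?K]) (auto simp: top)
qed

text \<open>The product of the compact sets is compact by Tychonoff's theorem. A functional on the
  product is the sum of its restrictions to the factors, hence a finite sum of continuous functions
  of single coordinates.\<close>

lemma weakly_compact_ball_finite_prod:
  fixes X :: "'i \<Rightarrow> ('k::{real_normed_field, euclidean_space}, 'a) normed_module"
  assumes I: "finite I" and N: "\<And>i. i \<in> I \<Longrightarrow> normed_space (X i)"
    and W: "\<And>i. i \<in> I \<Longrightarrow> weakly_compact_ball (X i)"
  shows "weakly_compact_ball (finite_prod_space I X)"
proof -
  let ?P = "finite_prod_space I X"
  interpret P: normed_space ?P using I N by (rule normed_space_finite_prod)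
  have "\<forall>i. \<exists>K. i \<in> I \<longrightarrow> compact_space K \<and> topspace K \<subseteq> carrier (X i) \<and>
        (\<forall>x\<in>carrier (X i). nrm (X i) x \<le> 1 \<longrightarrow> x \<in> topspace K) \<and>
        (\<forall>f\<in>bounded_linear_maps (X i) scalar_space. continuous_map K euclidean f)"
    using W[unfolded weakly_compact_ball_def] by simp
  from choice[OF this] obtain K where "\<forall>i. i \<in> I \<longrightarrow> compact_space (K i) \<and>
        topspace (K i) \<subseteq> carrier (X i) \<and>
        (\<forall>x\<in>carrier (X i). nrm (X i) x \<le> 1 \<longrightarrow> x \<in> topspace (K i)) \<and>
        (\<forall>f\<in>bounded_linear_maps (X i) scalar_space. continuous_map (K i) euclidean f)" ..
  then have K: "\<And>i. i \<in> I \<Longrightarrow> compact_space (K i)"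
    "\<And>i. i \<in> I \<Longrightarrow> topspace (K i) \<subseteq> carrier (X i)"
    "\<And>i x. i \<in> I \<Longrightarrow> x \<in> carrier (X i) \<Longrightarrow> nrm (X i) x \<le> 1 \<Longrightarrow> x \<in> topspace (K i)"
    "\<And>i f. i \<in> I \<Longrightarrow> f \<in> bounded_linear_maps (X i) scalar_space \<Longrightarrow> continuous_map (K i) euclidean f"
    by simp_all
  let ?K = "product_topology K I"
  have sub: "topspace ?K \<subseteq> carrier ?P" using K(2) by (auto intro!: PiE_mono)
  have cont: "continuous_map ?K euclidean f" if f: "f \<in> bounded_linear_maps ?P scalar_space" for f
  proof -
    obtain C where C: "0 \<le> C" "f \<in> dual_ball ?P C" using P.functional_dual_ball[OF f] .
    \<comment> \<open>The embedding of factor \<open>i\<close> into the product. It does not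
      increase the norm, so restricting \<open>f\<close> along it keeps the bound
      \<open>C\<close>.\<close>
    let ?e = "\<lambda>i a. \<lambda>j\<in>I. if j = i then a else zero (X j)"
    let ?f = "\<lambda>i. \<lambda>a\<in>carrier (X i). f (?e i a)"
    have z: "zero (X j) \<in> carrier (X j)" "zero (X j) \<oplus>\<^bsub>X j\<^esub> zero (X j) = zero (X j)"
      "smult (X j) c (zero (X j)) = zero (X j)" "nrm (X j) (zero (X j)) = 0"
      "\<And>a. a \<in> carrier (X j) \<Longrightarrow> zero (X j) \<oplus>\<^bsub>X j\<^esub> a = a"
      "\<And>a. a \<in> carrier (X j) \<Longrightarrow> a \<oplus>\<^bsub>X j\<^esub> zero (X j) = a"
      "\<And>a. a \<in> carrier (X j) \<Longrightarrow> 0 \<le> nrm (X j) a"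
      "\<And>a b. a \<in> carrier (X j) \<Longrightarrow> b \<in> carrier (X j) \<Longrightarrow> a \<oplus>\<^bsub>X j\<^esub> b \<in> carrier (X j)"
      "\<And>a. a \<in> carrier (X j) \<Longrightarrow> smult (X j) c a \<in> carrier (X j)" if j: "j \<in> I" for j c
    proof -
      interpret normed_space "X j" by (rule N[OF j])
      show "zero (X j) \<in> carrier (X j)" "zero (X j) \<oplus>\<^bsub>X j\<^esub> zero (X j) = zero (X j)"
        "smult (X j) c (zero (X j)) = zero (X j)" "nrm (X j) (zero (X j)) = 0"
        "\<And>a. a \<in> carrier (X j) \<Longrightarrow> zero (X j) \<oplus>\<^bsub>X j\<^esub> a = a"
        "\<And>a. a \<in> carrier (X j) \<Longrightarrow> a \<oplus>\<^bsub>X j\<^esub> zero (X j) = a"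
        "\<And>a. a \<in> carrier (X j) \<Longrightarrow> 0 \<le> nrm (X j) a"
        "\<And>a b. a \<in> carrier (X j) \<Longrightarrow> b \<in> carrier (X j) \<Longrightarrow> a \<oplus>\<^bsub>X j\<^esub> b \<in> carrier (X j)"
        "\<And>a. a \<in> carrier (X j) \<Longrightarrow> smult (X j) c a \<in> carrier (X j)"
        by (auto simp: nrm_nonneg)
    qed
    have e_in: "?e i a \<in> carrier ?P" if "i \<in> I" "a \<in> carrier (X i)" for i a
      using that z(1) by auto
    have f_i: "?f i \<in> dual_ball (X i) C" if i: "i \<in> I" for i
    proof (rule dual_ballI)
      fix a b assume a: "a \<in> carrier (X i)" and b: "b \<in> carrier (X i)"
      have "?e i (a \<oplus>\<^bsub>X i\<^esub> b) = ?e i a \<oplus>\<^bsub>?P\<^esub> ?e i b"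
        using i z(2) by (auto simp: fun_eq_iff restrict_def)
      then show "?f i (a \<oplus>\<^bsub>X i\<^esub> b) = ?f i a + ?f i b"
        using dual_ballD(2)[OF C(2) e_in[OF i a] e_in[OF i b]] a b z(8)[OF i] by simp
    next
      fix a c assume a: "a \<in> carrier (X i)"
      have "?e i (c \<odot>\<^bsub>X i\<^esub> a) = c \<odot>\<^bsub>?P\<^esub> ?e i a"
        using i z(3) by (auto simp: fun_eq_iff restrict_def)
      then show "?f i (c \<odot>\<^bsub>X i\<^esub> a) = c * ?f i a"
        using dual_ballD(3)[OF C(2) e_in[OF i a], of c] a z(9)[OF i] by simp
    next
      fix a assume a: "a \<in> carrier (X i)"
      have "nrm ?P (?e i a) \<le> nrm (X i) a"
        unfolding finite_prod_nrm_le_iff[OF I] using z(4,7) i a by auto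
      then have "C * nrm ?P (?e i a) \<le> C * nrm (X i) a" using C(1) by (rule mult_left_mono)
      then show "norm (?f i a) \<le> C * nrm (X i) a"
        using dual_ballD(4)[OF C(2) e_in[OF i a]] a by simp
    qed simp
    \<comment> \<open>Induction on the set of coordinates retained: a new coordinate adds one
      embedded vector to a vector that vanishes there.\<close>
    have partial: "f (\<lambda>i\<in>I. if i \<in> J then x i else zero (X i)) = (\<Sum>i\<in>J. ?f i (x i))"
      if x: "x \<in> carrier ?P" and J: "J \<subseteq> I" for x J
      using finite_subset[OF J I] J
    proof (induction J rule: finite_induct)
      case empty
      have "(\<lambda>i\<in>I. if i \<in> {} then x i else zero (X i)) = zero ?P" by (simp add: restrict_def)
      then show ?case using P.dual_ball_zero[OF C(2)] by (simp only: sum.empty)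
    next
      case (insert k J)
      let ?v = "\<lambda>J. \<lambda>i\<in>I. if i \<in> J then x i else zero (X i)"
      have k: "k \<in> I" "x k \<in> carrier (X k)" using insert.prems x by auto
      have v: "?v J \<in> carrier ?P" using x z(1) by auto
      have xi: "x i \<in> carrier (X i)" if "i \<in> I" for i using x that by auto
      have "?v (insert k J) = ?e k (x k) \<oplus>\<^bsub>?P\<^esub> ?v J"
        using insert.hyps(2) z(2,5,6) xi by (auto simp: fun_eq_iff restrict_def)
      then have "f (?v (insert k J)) = f (?e k (x k)) + f (?v J)"
        using dual_ballD(2)[OF C(2) e_in[OF k] v] by simp
      moreover have "f (?v J) = (\<Sum>i\<in>J. ?f i (x i))" using insert.IH insert.prems by blast
      moreover have "f (?e k (x k)) = ?f k (x k)" using k(2) by (rule restrict_apply'[symmetric])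
      ultimately show ?case by (simp only: sum.insert[OF insert.hyps])
    qed
    have sum: "f x = (\<Sum>i\<in>I. ?f i (x i))" if x: "x \<in> carrier ?P" for x
    proof -
      have "(\<lambda>i\<in>I. if i \<in> I then x i else zero (X i)) = x"
        using x by (auto simp: PiE_def extensional_def fun_eq_iff)
      then show ?thesis using partial[OF x subset_refl] by simp
    qed
    have "continuous_map ?K euclidean (\<lambda>x. \<Sum>i\<in>I. ?f i (x i))"
    proof (rule continuous_map_sum[OF I])
      fix i assume i: "i \<in> I"
      have "continuous_map (K i) euclidean (?f i)"
        using f_i[OF i] by (intro K(4)[OF i]) (auto simp: functional_iff_dual_ball)
      from continuous_map_compose[OF continuous_map_product_projection[OF i, of K] this]
      show "continuous_map ?K euclidean (\<lambda>x. ?f i (x i))" by (simp add: o_def)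
    qed
    then show ?thesis
      by (rule continuous_map_eq) (use sum sub in auto)
  qed
  have "compact_space ?K" using K(1) by (simp add: compact_space_product_topology)
  \<comment> \<open>A vector of maximum norm at most 1 has all its coordinates in the unit balls of
    the factors.\<close>
  moreover have "x \<in> topspace ?K" if x: "x \<in> carrier ?P" "nrm ?P x \<le> 1" for x
    using x K(3) unfolding finite_prod_nrm_le_iff[OF I] by (auto simp: PiE_def Pi_def)
  ultimately show ?thesis
    unfolding weakly_compact_ball_def using sub cont by (intro exI[of _ ?K]) blast
qed

lemma BFU_space_finite_prod:
  fixes X :: "'i \<Rightarrow> ('k::{real_normed_field, euclidean_space}, 'a) normed_module"
  assumes I: "finite I"
    and X: "\<And>i. i \<in> I \<Longrightarrow> reflexive_banach_space (X i) \<or> separable_banach_space (X i)"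
  shows "BFU_space (finite_prod_space I X)"
proof -
  \<comment> \<open>A factor that is both separable and reflexive is counted as separable. Either
    block may be empty, and its product is then the zero space.\<close>
  define S where "S = {i \<in> I. separable_banach_space (X i)}"
  define R where "R = I - S"
  have fin: "finite S" "finite R" and sub: "S \<subseteq> I" "R \<subseteq> I" using I by (auto simp: S_def R_def)
  have B: "banach_space (X i)" and N: "normed_space (X i)" if "i \<in> I" for i
    using X[OF that] by (auto simp: reflexive_banach_space_def separable_banach_space_def banach_space_def)
  have R: "reflexive_banach_space (X i)" if "i \<in> R" for i
    using X[of i] that by (auto simp: R_def S_def)
  let ?S = "finite_prod_space S X" and ?R = "finite_prod_space R X" and ?I = "finite_prod_space I X"
  have NS: "normed_space ?S" and NR: "normed_space ?R"
    using fin sub N by (auto intro!: normed_space_finite_prod)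
  have "banach_space ?R" using fin sub B by (intro banach_space_finite_prod) auto
  moreover have "weakly_compact_ball ?R"
    using fin sub N R by (intro weakly_compact_ball_finite_prod weakly_compact_ball_reflexive) auto
  ultimately have "BFU_space ?R" by (rule BFU_space_weakly_compact_ball)
  moreover have "separable_banach_space ?S"
    using fin(1) by (rule separable_banach_space_finite_prod) (simp add: S_def)
  ultimately have prod: "BFU_space (prod_space ?S ?R)" by (intro BFU_space_prod)
  \<comment> \<open>Reassembles a family from its separable and its reflexive part. It bounds the
    maximum over \<open>I\<close> by the larger of the maxima over \<open>S\<close> and
    \<open>R\<close>, and restricting a family to both blocks yields a preimage.\<close>
  define T where "T = (\<lambda>p\<in>carrier (prod_space ?S ?R). \<lambda>i\<in>I. if i \<in> S then fst p i else snd p i)"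
  have T_apply: "T (x, y) = (\<lambda>i\<in>I. if i \<in> S then x i else y i)"
    if "x \<in> carrier ?S" "y \<in> carrier ?R" for x y
    using that by (simp add: T_def cong: if_cong)
  have T_in: "T (x, y) \<in> carrier ?I" if "x \<in> carrier ?S" "y \<in> carrier ?R" for x y
  proof -
    have "(if i \<in> S then x i else y i) \<in> carrier (X i)" if i: "i \<in> I" for i
      using \<open>x \<in> carrier ?S\<close> \<open>y \<in> carrier ?R\<close> i by (auto simp: R_def)
    then show ?thesis unfolding T_apply[OF that] by auto
  qed
  interpret S: normed_space ?S by (rule NS)
  interpret R: normed_space ?R by (rule NR)
  have T_blm: "T \<in> bounded_linear_maps (prod_space ?S ?R) ?I"
    unfolding bounded_linear_maps_def
  proof (intro CollectI conjI exI[of _ 1] ballI allI)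
    show "T \<in> carrier (prod_space ?S ?R) \<rightarrow>\<^sub>E carrier ?I"
      using T_in by (intro PiE_I) (auto simp: T_def simp del: finite_prod_space_simps)
    fix p assume p: "p \<in> carrier (prod_space ?S ?R)"
    then obtain x y where xy: "p = (x, y)" "x \<in> carrier ?S" "y \<in> carrier ?R" by auto
    show "nrm ?I (T p) \<le> 1 * nrm (prod_space ?S ?R) p"
    proof -
      have "nrm (X i) (if i \<in> S then x i else y i) \<le> max (nrm ?S x) (nrm ?R y)" if i: "i \<in> I" for i
        using finite_prod_nrm_component[OF fin(1), of i X x] finite_prod_nrm_component[OF fin(2), of i X y] i
        by (auto simp: R_def le_max_iff_disj)
      then have "nrm ?I (T p) \<le> max (nrm ?S x) (nrm ?R y)"
        unfolding finite_prod_nrm_le_iff[OF I] xy(1) T_apply[OF xy(2,3)]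
        using S.nrm_nonneg[OF xy(2)] by (auto simp: le_max_iff_disj)
      then show ?thesis by (simp add: xy(1))
    qed
    show "T (c \<odot>\<^bsub>prod_space ?S ?R\<^esub> p) = c \<odot>\<^bsub>?I\<^esub> T p" for c
    proof -
      have "T (c \<odot>\<^bsub>?S\<^esub> x, c \<odot>\<^bsub>?R\<^esub> y) = c \<odot>\<^bsub>?I\<^esub> T (x, y)"
        unfolding T_apply[OF S.smult_in[OF xy(2)] R.smult_in[OF xy(3)]] T_apply[OF xy(2,3)]
        by (auto simp: fun_eq_iff restrict_def R_def)
      then show ?thesis by (simp only: xy(1) prod_space_simps)
    qed
    fix q assume "q \<in> carrier (prod_space ?S ?R)"
    then obtain x' y' where xy': "q = (x', y')" "x' \<in> carrier ?S" "y' \<in> carrier ?R" by auto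
    have "T (x \<oplus>\<^bsub>?S\<^esub> x', y \<oplus>\<^bsub>?R\<^esub> y') = T (x, y) \<oplus>\<^bsub>?I\<^esub> T (x', y')"
      unfolding T_apply[OF S.M.a_closed[OF xy(2) xy'(2)] R.M.a_closed[OF xy(3) xy'(3)]]
        T_apply[OF xy(2,3)] T_apply[OF xy'(2,3)]
      by (auto simp: fun_eq_iff restrict_def R_def)
    then show "T (p \<oplus>\<^bsub>prod_space ?S ?R\<^esub> q) = T p \<oplus>\<^bsub>?I\<^esub> T q"
      by (simp only: xy(1) xy'(1) prod_space_simps)
  qed
  show ?thesis
  proof (rule BFU_space_image[OF prod _ T_blm])
    show "banach_space ?I" using I B by (rule banach_space_finite_prod)
    show "T ` carrier (prod_space ?S ?R) = carrier ?I"
    proof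
      show "T ` carrier (prod_space ?S ?R) \<subseteq> carrier ?I"
        using bounded_linear_mapsD(1)[OF T_blm] by blast
      show "carrier ?I \<subseteq> T ` carrier (prod_space ?S ?R)"
      proof
        fix z assume z: "z \<in> carrier ?I"
        let ?x = "\<lambda>i\<in>S. z i" and ?y = "\<lambda>i\<in>R. z i"
        have xy: "?x \<in> carrier ?S" "?y \<in> carrier ?R" using z sub by auto
        have "T (?x, ?y) = z"
          unfolding T_apply[OF xy] using z by (auto simp: fun_eq_iff R_def PiE_def extensional_def)
        moreover have "(?x, ?y) \<in> carrier (prod_space ?S ?R)"
          using xy by (simp only: prod_space_simps mem_Times_iff fst_conv snd_conv)
        ultimately show "z \<in> T ` carrier (prod_space ?S ?R)" by (metis imageI)
      qed
    qed
  qed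
qed

lemma BFU_space_reflexive: "reflexive_banach_space X \<Longrightarrow> BFU_space X"
  by (intro BFU_space_weakly_compact_ball weakly_compact_ball_reflexive)
    (simp_all add: reflexive_banach_space_def)

theorem lemma3p1p3:
  shows
   "(\<forall>X :: ('k::{real_normed_field, euclidean_space}, 'a) normed_module.
       separable_banach_space X \<longrightarrow> BFU_space X) \<and>
    (\<forall>X :: ('k, 'a) normed_module.
       reflexive_banach_space X \<longrightarrow> BFU_space X) \<and>
    (\<forall>(X :: ('k, 'a) normed_module) (Y :: ('k, 'b) normed_module).
       separable_banach_space X \<longrightarrow> BFU_space Y \<longrightarrow> BFU_space (prod_space X Y)) \<and>
    (\<forall>(I :: 'i set) (X :: 'i \<Rightarrow> ('k, 'a) normed_module).
       finite I \<longrightarrow>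
       (\<forall>i\<in>I. reflexive_banach_space (X i) \<or> separable_banach_space (X i)) \<longrightarrow>
       BFU_space (finite_prod_space I X)) \<and>
    (\<forall>(X :: ('k, 'a) normed_module) M.
       BFU_space X \<longrightarrow> closed_subspace M X \<longrightarrow> BFU_space (quotient_space X M)) \<and>
    (\<forall>(X :: ('k, 'a) normed_module) M.
       BFU_space X \<longrightarrow> complemented_subspace M X \<longrightarrow> BFU_space (subspace_space X M))"
  by (intro conjI allI impI;
      (erule BFU_space_separable | erule BFU_space_reflexive | erule (1) BFU_space_prod |
        (erule BFU_space_finite_prod, blast) | erule (1) BFU_space_quotient |
        erule (1) BFU_space_complemented))

end
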